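(* Let $n\ge1$ and $p>n$. There exists a constant $C(n,p)>0$, depending only on $n$ and $p$, such that for every domain $\Omega\subset\mathbb{R}^n$ containing the origin and having finite volume $\mathcal{L}^n(\Omega)$, and for all $u\in C_c^\infty(\Omega\setminus\{0\})$, $$\sup_{x\in\Omega}|u(x)|\le C(n,p)\,[\mathcal{L}^n(\Omega)]^{1/n-1/p}\left(\int_\Omega|\nabla u|^pdx-\Big(\frac{p-n}{p}\Big)^p\int_\Omega\frac{|u|^p}{|x|^p}dx\right)^{1/p}.$$
   Context: A domain is an open connected subset of $\mathbb{R}^n$; $\mathcal{L}^n$ is Lebesgue measure. *)

theory Defs
  imports "HOL-Analysis.Analysis"
begin

definition partial_deriv :: "'n::finite \<Rightarrow> (real ^ 'n \<Rightarrow> real) \<Rightarrow> real ^ 'n \<Rightarrow> real" where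
  "partial_deriv i f x = frechet_derivative f (at x) (axis i 1)"

definition gradient :: "(real ^ 'n::finite \<Rightarrow> real) \<Rightarrow> real ^ 'n \<Rightarrow> real ^ 'n" where
  "gradient f x = (\<chi> i. partial_deriv i f x)"

(* Meant for open S: all derivatives are taken with respect to the full neighbourhood filter. *)
primrec Ck_on :: "nat \<Rightarrow> (real ^ 'n::finite) set \<Rightarrow> (real ^ 'n \<Rightarrow> real) \<Rightarrow> bool" where
  "Ck_on 0 S f \<longleftrightarrow> continuous_on S f"
| "Ck_on (Suc k) S f \<longleftrightarrow>
     (\<forall>x\<in>S. f differentiable (at x)) \<and> (\<forall>i. Ck_on k S (partial_deriv i f))"

definition smooth_on :: "(real ^ 'n::finite) set \<Rightarrow> (real ^ 'n \<Rightarrow> real) \<Rightarrow> bool" where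
  "smooth_on S f \<longleftrightarrow> (\<forall>k. Ck_on k S f)"

(* A test function on S is represented by its extension by zero to the whole space. *)
definition Cc_infinity :: "(real ^ 'n::finite) set \<Rightarrow> (real ^ 'n \<Rightarrow> real) set" where
  "Cc_infinity S =
     {f. smooth_on S f \<and> compact (closure {x. f x \<noteq> 0}) \<and> closure {x. f x \<noteq> 0} \<subseteq> S}"

(* For p > n and u in Cc_infinity (\<Omega> - {0}) both integrands are continuous with compact
   support (at x = 0 the second one is 0 / 0 = 0), so the Bochner integrals are genuine. *)
definition hardy_difference :: "real \<Rightarrow> (real ^ 'n::finite) set \<Rightarrow> (real ^ 'n \<Rightarrow> real) \<Rightarrow> real" where
  "hardy_difference p \<Omega> u =
     (LINT x:\<Omega>|lebesgue. norm (gradient u x) powr p)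
     - ((p - real CARD('n)) / p) powr p * (LINT x:\<Omega>|lebesgue. \<bar>u x\<bar> powr p / norm x powr p)"

end

theory Submission
  imports Defs
begin

text \<open>
  Write \<open>n\<close> for the dimension, \<open>\<alpha> = (p - n) / p\<close> and \<open>A = \<alpha> u x / |x|\<^sup>2\<close>. Since \<open>x / |x|\<^sup>n\<close> is
  divergence free away from the origin, the Hardy difference equals the integral of the Bregman
  distance \<open>D\<close> between \<open>A\<close> and \<open>\<nabla>u\<close> for the convex function \<open>|\<cdot>|\<^sup>p\<close>; in particular it is nonnegative.

  If \<open>n \<ge> 2\<close>, then \<open>p \<ge> 2\<close> and \<open>D\<close> dominates a multiple of \<open>|\<nabla>u - A|\<^sup>p = |x|\<^bsup>\<alpha> p\<^esup> |\<nabla>(u / |x|\<^sup>\<alpha>)|\<^sup>p\<close>.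
  Given \<open>x\<close>, take a cube with a corner at \<open>x\<close>, pointing away from the origin and of volume twice that
  of \<open>\<Omega>\<close>. At least half of it lies outside \<open>\<Omega>\<close>, where \<open>u\<close> vanishes, and Morrey's argument along the
  segments from \<open>x\<close> to these points bounds \<open>u(x)\<close>: along them \<open>|z| \<ge> |x|\<close>, so the quotient of the weights
  is at most 1.

  If \<open>n = 1\<close>, possibly \<open>p < 2\<close> and this lower bound for \<open>D\<close> fails. Instead, \<open>D \<ge> - \<kappa> (|u|\<^sup>p)'\<close> on the
  interval from \<open>x\<close> outwards to a point at distance \<open>2 |\<Omega>|\<close> from the origin, where
  \<open>\<kappa> = (\<alpha> / (2 |\<Omega>|))\<^bsup>p - 1\<^esup>\<close>, and integration gives \<open>\<kappa> |u(x)|\<^sup>p\<close>.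
\<close>

section \<open>Inequalities for powers of norms\<close>

text \<open>Young's inequality for \<open>a\<close> and \<open>c powr (p - 1)\<close> with conjugate
  exponents p and p / (p - 1). Equivalently, the graph of t^p lies above its tangent at
  \<open>c\<close>.\<close>

lemma Young_tangent:
  fixes a c p :: real
  assumes "p > 1" "a \<ge> 0" "c \<ge> 0"
  shows "p * (a * c powr (p - 1)) \<le> a powr p + (p - 1) * c powr p"
proof -
  have "a * c powr (p - 1) \<le> a powr p / p + (c powr (p - 1)) powr (p / (p - 1)) / (p / (p - 1))"
    by (rule Youngs_inequality) (use assms in \<open>auto simp: field_simps\<close>)
  also have "(c powr (p - 1)) powr (p / (p - 1)) = c powr p"
    using assms by (simp add: powr_powr)
  finally have "p * (a * c powr (p - 1)) \<le> p * (a powr p / p + c powr p / (p / (p - 1)))"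
    using assms by (intro mult_left_mono) auto
  also have "\<dots> = a powr p + (p - 1) * c powr p"
    using assms by (simp add: field_simps)
  finally show ?thesis .
qed

text \<open>Adding the tangent inequalities at the midpoint \<open>c\<close>, taken at a and at b,
  makes the linear terms combine into a multiple of \<open>c powr q\<close>.\<close>

lemma powr_midpoint_le:
  fixes a b q :: real
  assumes "q \<ge> 1" "a \<ge> 0" "b \<ge> 0"
  shows "((a + b) / 2) powr q \<le> (a powr q + b powr q) / 2"
proof (cases "q = 1")
  case False
  define c where "c = (a + b) / 2"
  have c: "c \<ge> 0" and q: "q > 1" using assms False by (auto simp: c_def)
  have cq: "c * c powr (q - 1) = c powr q"
    using c by (cases "c = 0") (auto simp: powr_diff)
  have "q * (a * c powr (q - 1)) + q * (b * c powr (q - 1))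
      \<le> a powr q + b powr q + 2 * (q - 1) * c powr q"
    using Young_tangent[OF q assms(2) c] Young_tangent[OF q assms(3) c] by linarith
  moreover have "q * (a * c powr (q - 1)) + q * (b * c powr (q - 1)) = 2 * q * (c * c powr (q - 1))"
    by (simp add: c_def algebra_simps)
  ultimately show ?thesis
    unfolding cq c_def[symmetric] by (simp add: algebra_simps)
qed (use assms in auto)

text \<open>After division by a + b both arguments lie in [0,1], where t^q \<le> t, and the two
  fractions add up to 1.\<close>

lemma powr_add_le_powr_add:
  fixes a b q :: real
  assumes "q \<ge> 1" "a \<ge> 0" "b \<ge> 0"
  shows "a powr q + b powr q \<le> (a + b) powr q"
proof (cases "a + b = 0")
  case False
  then have s: "a + b > 0" using assms by auto
  have le: "x powr q \<le> x / (a + b) * (a + b) powr q" if "0 \<le> x" "x \<le> a + b" for x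
  proof -
    have "(x / (a + b)) powr q \<le> (x / (a + b)) powr 1"
      using that s assms by (intro powr_mono') auto
    then have "(x / (a + b)) powr q * (a + b) powr q \<le> x / (a + b) * (a + b) powr q"
      using that s by (intro mult_right_mono) auto
    then show ?thesis
      using that s by (simp add: powr_divide)
  qed
  have "a powr q + b powr q \<le> a / (a + b) * (a + b) powr q + b / (a + b) * (a + b) powr q"
    using le[of a] le[of b] assms by auto
  also have "\<dots> = (a + b) powr q"
    using s by (simp flip: distrib_right add_divide_distrib)
  finally show ?thesis .
next
  case True
  then have "a = 0" "b = 0" using assms by auto
  then show ?thesis by simp
qed

text \<open>Both sides are powers p / 2 \<ge> 1 of squared norms: superadditivity joins the two
  terms on the left, the parallelogram law evaluates the sum of squares, and midpoint convexity
  splits it again.\<close>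

lemma Clarkson_midpoint:
  fixes x y :: "'a::real_inner"
  assumes p: "p \<ge> 2"
  shows "norm ((x + y) /\<^sub>R 2) powr p + norm ((x - y) /\<^sub>R 2) powr p \<le> (norm x powr p + norm y powr p) / 2"
proof -
  have sq: "norm z powr p = ((norm z)\<^sup>2) powr (p / 2)" for z :: 'a
  proof -
    have "(norm z)\<^sup>2 = norm z powr 2" by simp
    then show ?thesis by (simp only: powr_powr) simp
  qed
  have "norm ((x + y) /\<^sub>R 2) powr p + norm ((x - y) /\<^sub>R 2) powr p
      \<le> ((norm ((x + y) /\<^sub>R 2))\<^sup>2 + (norm ((x - y) /\<^sub>R 2))\<^sup>2) powr (p / 2)"
    unfolding sq using p by (intro powr_add_le_powr_add) auto
  also have "(norm ((x + y) /\<^sub>R 2))\<^sup>2 + (norm ((x - y) /\<^sub>R 2))\<^sup>2 = ((norm x)\<^sup>2 + (norm y)\<^sup>2) / 2"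
    by (simp add: power2_norm_eq_inner inner_add_left inner_add_right inner_diff_left
        inner_diff_right inner_commute field_simps)
  also have "\<dots> powr (p / 2) \<le> (((norm x)\<^sup>2) powr (p / 2) + ((norm y)\<^sup>2) powr (p / 2)) / 2"
    using p by (intro powr_midpoint_le) auto
  finally show ?thesis by (simp only: sq)
qed

text \<open>The expanded form of |b|^p - |a|^p - p |a|^(p-2) a . (b - a), the error of the first
  order expansion of |.|^p at a. For a = 0 the value \<open>0 powr (p - 2) = 0\<close> makes the
  mixed term vanish also when p < 2.\<close>

definition bregman :: "real \<Rightarrow> 'a::real_inner \<Rightarrow> 'a \<Rightarrow> real" where
  "bregman p a b = norm b powr p - p * (norm a powr (p - 2) * (a \<bullet> b)) + (p - 1) * norm a powr p"

text \<open>Cauchy-Schwarz reduces the inner product to the scalar tangent inequality with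
  \<open>c = norm a\<close>.\<close>

lemma Young_vector:
  fixes a b :: "'a::real_inner"
  assumes "p > 1"
  shows "p * (norm a powr (p - 2) * (a \<bullet> b)) \<le> norm b powr p + (p - 1) * norm a powr p"
proof -
  have "norm a powr (p - 2) * (a \<bullet> b) \<le> norm a powr (p - 2) * (norm a * norm b)"
    by (intro mult_left_mono norm_cauchy_schwarz) auto
  also have "\<dots> = norm b * norm a powr (p - 1)"
    by (cases "a = 0") (auto simp: powr_diff power2_eq_square powr_numeral)
  finally have "p * (norm a powr (p - 2) * (a \<bullet> b)) \<le> p * (norm b * norm a powr (p - 1))"
    using assms by (intro mult_left_mono) auto
  also have "\<dots> \<le> norm b powr p + (p - 1) * norm a powr p"
    using assms by (intro Young_tangent) auto
  finally show ?thesis .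
qed

lemma bregman_nonneg: "p > 1 \<Longrightarrow> 0 \<le> bregman p a b"
  using Young_vector[of p a b] by (simp add: bregman_def)

text \<open>The tangent at a is compared with |.|^p at the midpoint \<open>m\<close> of a and b,
  where Clarkson's inequality leaves a surplus |(b - a) / 2|^p. Doubling turns the factor 2^(-p)
  into 2^(1-p).\<close>

lemma bregman_lower_bound:
  fixes a b :: "'a::real_inner"
  assumes p: "p \<ge> 2"
  shows "2 powr (1 - p) * norm (b - a) powr p \<le> bregman p a b"
proof -
  define m where "m = (b + a) /\<^sub>R 2"
  have "norm m powr p + norm ((b - a) /\<^sub>R 2) powr p \<le> (norm b powr p + norm a powr p) / 2"
    unfolding m_def by (rule Clarkson_midpoint[OF p])
  moreover have "norm ((b - a) /\<^sub>R 2) powr p = norm (b - a) powr p / 2 powr p"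
    by (simp add: powr_divide)
  moreover have "2 powr (1 - p) = 2 / (2::real) powr p"
    by (simp add: powr_diff)
  moreover have "p * (norm a powr (p - 2) * (a \<bullet> m)) \<le> norm m powr p + (p - 1) * norm a powr p"
    using p by (intro Young_vector) auto
  moreover have "2 * (norm a powr (p - 2) * (a \<bullet> m)) = norm a powr (p - 2) * (a \<bullet> b) + norm a powr p"
  proof (cases "a = 0")
    case False
    then have "norm a powr p = norm a powr (p - 2) * (a \<bullet> a)"
      by (simp add: powr_diff powr_numeral power2_norm_eq_inner)
    then show ?thesis by (simp add: m_def inner_add_right algebra_simps)
  qed auto
  then have "p * (2 * (norm a powr (p - 2) * (a \<bullet> m)))
      = p * (norm a powr (p - 2) * (a \<bullet> b)) + p * norm a powr p"
    by (simp add: algebra_simps)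
  ultimately show ?thesis
    unfolding bregman_def by (simp add: algebra_simps)
qed

section \<open>A radial divergence identity\<close>

lemma nn_integral_lborel_affine:
  fixes f :: "'a::euclidean_space \<Rightarrow> ennreal"
  assumes "c \<noteq> 0" "f \<in> borel_measurable borel"
  shows "(\<integral>\<^sup>+x. f x \<partial>lborel) = ennreal (\<bar>c\<bar> ^ DIM('a)) * (\<integral>\<^sup>+x. f (t + c *\<^sub>R x) \<partial>lborel)"
proof -
  have [measurable]: "f \<in> borel_measurable borel" by fact
  have "(\<integral>\<^sup>+x. f x \<partial>lborel)
      = (\<integral>\<^sup>+x. f x \<partial>density (distr lborel borel (\<lambda>x. t + c *\<^sub>R x)) (\<lambda>_. \<bar>c\<bar> ^ DIM('a)))"
    using lborel_affine[OF assms(1), of t] by simp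
  also have "\<dots> = ennreal (\<bar>c\<bar> ^ DIM('a)) * (\<integral>\<^sup>+x. f (t + c *\<^sub>R x) \<partial>lborel)"
    by (simp add: nn_integral_density nn_integral_distr nn_integral_cmult)
  finally show ?thesis .
qed

lemma lborel_integral_scaleR:
  fixes f :: "'a::euclidean_space \<Rightarrow> real"
  assumes "c \<noteq> 0" "f \<in> borel_measurable borel"
  shows "(\<integral>x. f x \<partial>lborel) = \<bar>c\<bar> ^ DIM('a) * (\<integral>x. f (c *\<^sub>R x) \<partial>lborel)"
proof -
  have [measurable]: "f \<in> borel_measurable borel" by fact
  have "(\<integral>x. f x \<partial>lborel)
      = (\<integral>x. f x \<partial>density (distr lborel borel (\<lambda>x. 0 + c *\<^sub>R x)) (\<lambda>_. ennreal (\<bar>c\<bar> ^ DIM('a))))"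
    using lborel_affine[OF assms(1), of "0::'a"] by simp
  also have "\<dots> = \<bar>c\<bar> ^ DIM('a) * (\<integral>x. f (c *\<^sub>R x) \<partial>lborel)"
    by (simp add: integral_density integral_distr)
  finally show ?thesis .
qed

text \<open>Connects the Lebesgue integral, in which dilations are substituted, with the integral
  over a box, in which differentiation under the integral sign takes place.\<close>

lemma
  fixes f :: "'a::euclidean_space \<Rightarrow> real"
  assumes f: "continuous_on UNIV f" and out: "\<And>x. x \<notin> cbox a b \<Longrightarrow> f x = 0"
  shows integrable_lborel_cbox_support: "integrable lborel f"
    and integral_lborel_cbox_support: "(\<integral>x. f x \<partial>lborel) = integral (cbox a b) f"
proof -
  have eq: "(\<lambda>x. indicator (cbox a b) x *\<^sub>R f x) = f"
    using out by (auto simp: indicator_def fun_eq_iff)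
  show int: "integrable lborel f"
    using borel_integrable_compact[OF compact_cbox continuous_on_subset[OF f subset_UNIV], of a b]
    by (simp only: eq)
  have "(\<lambda>x. if x \<in> cbox a b then f x else 0) = f"
    using out by auto
  then have "integral (cbox a b) f = integral UNIV f"
    using integral_restrict_UNIV[of "cbox a b" f] by simp
  then show "(\<integral>x. f x \<partial>lborel) = integral (cbox a b) f"
    using integral_lborel[OF int] by simp
qed

lemma cball_subset_symmetric_cbox:
  obtains a :: "'a::euclidean_space" where "cball 0 M \<subseteq> cbox (-a) a"
  using bounded_subset_cbox_symmetric[of "cball 0 M :: 'a set"] bounded_cball by blast

lemma integrable_lborel_bounded_support:
  fixes f :: "'a::euclidean_space \<Rightarrow> real"
  assumes "continuous_on UNIV f" "\<And>x. norm x > M \<Longrightarrow> f x = 0"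
  shows "integrable lborel f"
proof -
  obtain a :: 'a where "cball 0 M \<subseteq> cbox (-a) a" by (rule cball_subset_symmetric_cbox)
  then show ?thesis
    using assms by (intro integrable_lborel_cbox_support[of f "-a" a]) force+
qed

lemma gradient_eq_0_on_open:
  fixes G :: "'a::euclidean_space \<Rightarrow> 'a" and F :: "'a \<Rightarrow> real"
  assumes "(F has_derivative (\<lambda>h. G x \<bullet> h)) (at x)"
    and "open S" "x \<in> S" "\<And>y. y \<in> S \<Longrightarrow> F y = 0"
  shows "G x = 0"
proof -
  have "((\<lambda>_. 0) has_derivative (\<lambda>h. G x \<bullet> h)) (at x)"
    by (rule has_derivative_transform_within_open[OF assms(1-3)]) (use assms(4) in auto)
  then have "(\<lambda>h. G x \<bullet> h) = (\<lambda>h. 0)"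
    by (rule has_derivative_unique) (rule has_derivative_const)
  then have "G x \<bullet> G x = 0" by meson
  then show ?thesis by simp
qed

text \<open>The integral of \<open>F(s x) / |x|\<^sup>n\<close> does not depend on \<open>s > 0\<close>; differentiate at \<open>s = 1\<close>.\<close>

lemma integral_radial_derivative_eq_0:
  fixes G :: "'a::euclidean_space \<Rightarrow> 'a" and F :: "'a \<Rightarrow> real"
  assumes der: "\<And>x. (F has_derivative (\<lambda>h. G x \<bullet> h)) (at x)"
    and contG: "continuous_on UNIV G"
    and r: "r > 0" and near: "\<And>x. norm x < r \<Longrightarrow> F x = 0"
    and far: "\<And>x. norm x > M \<Longrightarrow> F x = 0"
  shows "(\<integral>x. (G x \<bullet> x) / norm x ^ DIM('a) \<partial>lborel) = 0"
proof -
  define n where "n = DIM('a)"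
  \<comment> \<open>The singular weight |x|^(-n) is frozen below radius r / 2 to become continuous.
    For s \<le> 2 this changes no integrand, because \<open>F (s *\<^sub>R x) = 0\<close> when |x| <
    r / 2.\<close>
  define w :: "'a \<Rightarrow> real" where "w x = 1 / max (norm x) (r / 2) ^ n" for x
  have contw: "continuous_on UNIV w"
    unfolding w_def using r by (intro continuous_intros) auto
  have contF: "continuous_on UNIV F"
    by (rule has_derivative_continuous_on[where f'="\<lambda>x h. G x \<bullet> h"]) (simp add: der)
  have w: "w x = 1 / norm x ^ n" if "norm x \<ge> r / 2" for x
    using that by (simp add: w_def max_absorb1)
  have G0: "G x = 0" if "norm x < r" for x
    by (rule gradient_eq_0_on_open[OF der open_ball[of 0 r]]) (use that near in auto)
  have GM: "G x = 0" if "norm x > M" for x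
  proof (rule gradient_eq_0_on_open[OF der])
    show "open {x::'a. M < norm x}" by (intro open_Collect_less continuous_intros)
  qed (use that far in auto)
  \<comment> \<open>Radius 2 M suffices for all s \<ge> 1/2: outside the box |s x| > M, so one box
    contains the supports of all dilates.\<close>
  obtain a :: 'a where a: "cball 0 (2 * M) \<subseteq> cbox (-a) a" by (rule cball_subset_symmetric_cbox)
  have out: "norm (s *\<^sub>R x) > M" if "x \<notin> cbox (-a) a" "s \<in> {1/2..2}" for s x
  proof -
    have "norm x > 2 * M" using that a by force
    moreover have "norm x \<le> 2 * norm (s *\<^sub>R x)" using that mult_right_mono[of "1/2" s "norm x"] by auto
    ultimately show ?thesis by linarith
  qed
  have contf: "continuous_on UNIV (\<lambda>x. F (s *\<^sub>R x) * w x)" for s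
    by (intro continuous_on_mult contw continuous_on_compose2[OF contF] continuous_intros) auto
  have const: "integral (cbox (-a) a) (\<lambda>x. F (s *\<^sub>R x) * w x) = (\<integral>x. F x / norm x ^ n \<partial>lborel)"
    if s: "s \<in> {1/2..2}" for s
  proof -
    have [measurable]: "F \<in> borel_measurable borel"
      by (rule borel_measurable_continuous_onI[OF contF])
    have "integral (cbox (-a) a) (\<lambda>x. F (s *\<^sub>R x) * w x) = (\<integral>x. F (s *\<^sub>R x) * w x \<partial>lborel)"
      by (rule integral_lborel_cbox_support[OF contf, symmetric]) (use out[OF _ s] far in auto)
    also have "\<dots> = (\<integral>x. s ^ n * (F (s *\<^sub>R x) / norm (s *\<^sub>R x) ^ n) \<partial>lborel)"
    proof (rule Bochner_Integration.integral_cong)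
      fix x :: 'a
      show "F (s *\<^sub>R x) * w x = s ^ n * (F (s *\<^sub>R x) / norm (s *\<^sub>R x) ^ n)"
      proof (cases "norm x \<ge> r / 2")
        case True
        then show ?thesis using s by (simp add: w power_mult_distrib)
      next
        case False
        then have "norm (s *\<^sub>R x) < r"
          using s mult_right_mono[of s 2 "norm x"] by auto
        then show ?thesis by (simp only: near)
      qed
    qed simp
    also have "\<dots> = s ^ n * (\<integral>x. F (s *\<^sub>R x) / norm (s *\<^sub>R x) ^ n \<partial>lborel)"
      by (rule integral_mult_right_zero)
    also have "\<dots> = (\<integral>x. F x / norm x ^ n \<partial>lborel)"
      using s by (subst (2) lborel_integral_scaleR[of s]) (auto simp: n_def)
    finally show ?thesis .
  qed
  have "((\<lambda>s. integral (cbox (-a) a) (\<lambda>x. F (s *\<^sub>R x) * w x)) has_vector_derivative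
      integral (cbox (-a) a) (\<lambda>x. (G (1 *\<^sub>R x) \<bullet> x) * w x)) (at 1 within {1/2..2})"
  proof (rule leibniz_rule_vector_derivative[where fx="\<lambda>s x. (G (s *\<^sub>R x) \<bullet> x) * w x"])
    fix s :: real and x :: 'a
    have "((\<lambda>s. F (s *\<^sub>R x)) has_derivative (\<lambda>h. G (s *\<^sub>R x) \<bullet> (h *\<^sub>R x))) (at s)"
      by (rule has_derivative_compose[of "\<lambda>s. s *\<^sub>R x" _ _ _ F, OF _ der]) (auto intro!: derivative_eq_intros)
    then have "((\<lambda>s. F (s *\<^sub>R x)) has_real_derivative (G (s *\<^sub>R x) \<bullet> x)) (at s)"
      by (simp add: has_field_derivative_def mult_commute_abs)
    then have "((\<lambda>s. F (s *\<^sub>R x) * w x) has_real_derivative (G (s *\<^sub>R x) \<bullet> x) * w x) (at s)"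
      by (auto intro!: derivative_eq_intros)
    then show "((\<lambda>s. F (s *\<^sub>R x) * w x) has_vector_derivative (G (s *\<^sub>R x) \<bullet> x) * w x) (at s within {1/2..2})"
      by (metis has_real_derivative_iff_has_vector_derivative has_vector_derivative_at_within)
  next
    show "continuous_on ({1/2..2} \<times> cbox (- a) a) (\<lambda>(s, x). (G (s *\<^sub>R x) \<bullet> x) * w x)"
      unfolding split_beta
      by (intro continuous_intros continuous_on_compose2[OF contG] continuous_on_compose2[OF contw]) auto
  qed (auto intro!: integrable_continuous continuous_on_subset[OF contf])
  then have "((\<lambda>s. integral (cbox (-a) a) (\<lambda>x. F (s *\<^sub>R x) * w x)) has_vector_derivative
      integral (cbox (-a) a) (\<lambda>x. (G x \<bullet> x) * w x)) (at 1)"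
    by (simp add: at_within_Icc_at)
  moreover have "((\<lambda>s. integral (cbox (-a) a) (\<lambda>x. F (s *\<^sub>R x) * w x)) has_vector_derivative 0) (at 1)"
    by (rule has_vector_derivative_transform_within_open[of "\<lambda>_. (\<integral>x. F x / norm x ^ n \<partial>lborel)" _ _ "{1/2<..<2}"])
      (auto simp: const)
  ultimately have "integral (cbox (-a) a) (\<lambda>x. (G x \<bullet> x) * w x) = 0"
    using vector_derivative_unique_at by blast
  moreover have "integral (cbox (-a) a) (\<lambda>x. (G x \<bullet> x) * w x) = (\<integral>x. (G x \<bullet> x) * w x \<partial>lborel)"
  proof (rule integral_lborel_cbox_support[symmetric])
    show "continuous_on UNIV (\<lambda>x. (G x \<bullet> x) * w x)"
      by (intro continuous_intros contG contw)
  qed (use out[of _ 1] GM in auto)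
  moreover have "(G x \<bullet> x) * w x = (G x \<bullet> x) / norm x ^ n" for x
  proof (cases "norm x \<ge> r / 2")
    case False
    then have "G x = 0" using r by (intro G0) auto
    then show ?thesis by simp
  qed (simp add: w)
  ultimately show ?thesis by (simp add: n_def)
qed

section \<open>The Hardy difference as a Bregman distance\<close>

text \<open>Splitting into powers of the positive and the negative part gives continuity across 0
  without a case distinction.\<close>

lemma continuous_on_sgn_powr:
  fixes q :: real
  assumes "q > 0"
  shows "continuous_on UNIV (\<lambda>s::real. sgn s * \<bar>s\<bar> powr q)"
proof -
  have "(\<lambda>s::real. sgn s * \<bar>s\<bar> powr q) = (\<lambda>s. max s 0 powr q - max (-s) 0 powr q)"
    by (auto simp: fun_eq_iff sgn_if max_def)
  moreover have "continuous_on UNIV (\<lambda>s::real. max s 0 powr q - max (-s) 0 powr q)"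
    using assms by (intro continuous_intros continuous_on_powr') auto
  ultimately show ?thesis by (simp only:)
qed

text \<open>At 0 the difference quotient is itself sgn h |h|^(p-1), which tends to 0 because p > 1.
  Elsewhere |s| coincides locally with s or with -s.\<close>

lemma DERIV_abs_powr:
  fixes p s :: real
  assumes "p > 1"
  shows "((\<lambda>s. \<bar>s\<bar> powr p) has_real_derivative p * (sgn s * \<bar>s\<bar> powr (p - 1))) (at s)"
proof (cases "s = 0")
  case True
  have "isCont (\<lambda>h::real. sgn h * \<bar>h\<bar> powr (p - 1)) 0"
    by (rule continuous_on_interior[OF continuous_on_sgn_powr]) (use assms in auto)
  then have "((\<lambda>h::real. sgn h * \<bar>h\<bar> powr (p - 1)) \<longlongrightarrow> sgn 0 * \<bar>0\<bar> powr (p - 1)) (at 0)"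
    by (simp only: isCont_def)
  moreover have "(\<bar>0 + h\<bar> powr p - \<bar>0\<bar> powr p) / h = sgn h * \<bar>h\<bar> powr (p - 1)" for h :: real
    by (cases "h = 0") (auto simp: powr_diff sgn_if abs_if)
  ultimately show ?thesis
    using True by (simp add: DERIV_def)
next
  case False
  show ?thesis
  proof (cases "s > 0")
    case True
    have "((\<lambda>s. s powr p) has_real_derivative p * s powr (p - 1)) (at s)"
      using True by (rule has_real_derivative_powr)
    then have "((\<lambda>s. \<bar>s\<bar> powr p) has_real_derivative p * s powr (p - 1)) (at s)"
      by (rule DERIV_cong_ev[THEN iffD1, rotated -1, OF _ refl _ refl])
        (use eventually_nhds_in_open[of "{0<..}" s] True in \<open>auto elim: eventually_mono\<close>)
    then show ?thesis using True by simp
  next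
    case neg: False
    then have s: "s < 0" using False by simp
    have "((\<lambda>s. (-s) powr p) has_real_derivative p * (-s) powr (p - 1) * (-1)) (at s)"
      using s by (auto intro!: derivative_eq_intros)
    then have "((\<lambda>s. \<bar>s\<bar> powr p) has_real_derivative p * (-s) powr (p - 1) * (-1)) (at s)"
      by (rule DERIV_cong_ev[THEN iffD1, rotated -1, OF _ refl _ refl])
        (use eventually_nhds_in_open[of "{..<0}" s] s in \<open>auto elim: eventually_mono\<close>)
    then show ?thesis using s by simp
  qed
qed

lemma has_derivative_norm_powr:
  fixes x :: "'a::real_inner"
  assumes "x \<noteq> 0"
  shows "((\<lambda>x. norm x powr c) has_derivative (\<lambda>h. c * norm x powr (c - 2) * (x \<bullet> h))) (at x)"
proof -
  have "((\<lambda>t. t powr c) has_derivative (\<lambda>h. c * norm x powr (c - 1) * h)) (at (norm x))"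
    using has_real_derivative_powr[of "norm x" c] assms by (simp add: has_field_derivative_def)
  from has_derivative_compose[OF has_derivative_norm[OF assms] this]
  have "((\<lambda>x. norm x powr c) has_derivative (\<lambda>h. c * norm x powr (c - 1) * (h \<bullet> sgn x))) (at x)"
    by (simp add: inner_commute)
  moreover have "c * norm x powr (c - 1) * (h \<bullet> sgn x) = c * norm x powr (c - 2) * (x \<bullet> h)" for h
    using assms by (simp add: sgn_div_norm powr_diff inner_commute power2_eq_square field_simps)
  ultimately show ?thesis by simp
qed

text \<open>Serves the functions with a singular weight at the origin: the open sets - {0} and a
  ball on which they vanish cover the space.\<close>

lemma continuous_on_UNIV_punctured:
  fixes f :: "'a::real_normed_vector \<Rightarrow> 'b::real_normed_vector"
  assumes "continuous_on (- {0}) f" "r > 0" "\<And>x. norm x < r \<Longrightarrow> f x = 0"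
  shows "continuous_on UNIV f"
proof -
  have "continuous_on (ball 0 r) f"
    using assms(3) by (subst continuous_on_cong[OF refl, of _ f "\<lambda>_. 0"]) auto
  then have "continuous_on (- {0} \<union> ball 0 r) f"
    by (intro continuous_on_open_Un assms(1)) auto
  moreover have "- {0} \<union> ball 0 r = (UNIV :: 'a set)" using assms(2) by auto
  ultimately show ?thesis by simp
qed

section \<open>Functions supported in an annulus r \<le> |x| \<le> M\<close>

locale punctured_test_function =
  fixes u :: "'a::euclidean_space \<Rightarrow> real" and G :: "'a \<Rightarrow> 'a" and r M p :: real
  assumes der: "\<And>x. (u has_derivative (\<lambda>h. G x \<bullet> h)) (at x)"
    and contG: "continuous_on UNIV G"
    and r: "r > 0" and near: "\<And>x. norm x < r \<Longrightarrow> u x = 0"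
    and far: "\<And>x. norm x > M \<Longrightarrow> u x = 0"
    and p: "p > real DIM('a)"
begin

definition \<alpha> :: real where "\<alpha> = (p - real DIM('a)) / p"

text \<open>The gradient of c |x|^\<alpha>, with the constant c chosen so that this function agrees
  with \<open>u\<close> at the point in question; |x|^\<alpha> plays the role of the ground
  state.\<close>

definition A :: "'a \<Rightarrow> 'a" where "A x = (\<alpha> * u x / (norm x)\<^sup>2) *\<^sub>R x"

definition D :: "'a \<Rightarrow> real" where "D x = bregman p (A x) (G x)"

lemma p_gt_1: "p > 1"
  using p DIM_positive[where 'a='a] by linarith

lemma \<alpha>_pos: "\<alpha> > 0" and p_\<alpha>: "p * \<alpha> = p - real DIM('a)"
  using p p_gt_1 by (auto simp: \<alpha>_def)

lemma contu: "continuous_on UNIV u"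
  by (rule has_derivative_continuous_on[where f'="\<lambda>x h. G x \<bullet> h"]) (simp add: der)

lemma G_near: "norm x < r \<Longrightarrow> G x = 0"
  by (rule gradient_eq_0_on_open[OF der open_ball[of 0 r]]) (use near in auto)

lemma G_far: "norm x > M \<Longrightarrow> G x = 0"
proof (rule gradient_eq_0_on_open[OF der])
  show "open {x::'a. M < norm x}" by (intro open_Collect_less continuous_intros)
qed (use far in auto)

lemma contA: "continuous_on UNIV A"
  unfolding A_def
  by (rule continuous_on_UNIV_punctured[OF _ r])
    (auto intro!: continuous_intros continuous_on_subset[OF contu] simp: near)

lemma norm_A: "norm (A x) = \<alpha> * \<bar>u x\<bar> / norm x"
  using \<alpha>_pos by (simp add: A_def power2_eq_square abs_mult)

lemma D_nonneg: "0 \<le> D x"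
  unfolding D_def using p_gt_1 by (rule bregman_nonneg)

text \<open>The gradient of F = |u|^p |x|^(n-p). This F is chosen so that F / |x|^n is the Hardy
  potential |u|^p / |x|^p; the radial identity is applied to it.\<close>

definition GF :: "'a \<Rightarrow> 'a" where
  "GF x = (p * (sgn (u x) * \<bar>u x\<bar> powr (p - 1)) * norm x powr (real DIM('a) - p)) *\<^sub>R G x
    + ((real DIM('a) - p) * \<bar>u x\<bar> powr p * norm x powr (real DIM('a) - p - 2)) *\<^sub>R x"

lemma has_derivative_abs_powr_u:
  "((\<lambda>x. \<bar>u x\<bar> powr p) has_derivative (\<lambda>h. p * (sgn (u x) * \<bar>u x\<bar> powr (p - 1)) * (G x \<bullet> h))) (at x)"
  using has_derivative_compose[OF der, of "\<lambda>s. \<bar>s\<bar> powr p"] DERIV_abs_powr[OF p_gt_1, of "u x"]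
  by (simp add: has_field_derivative_def)

lemma has_derivative_F:
  "((\<lambda>x. \<bar>u x\<bar> powr p * norm x powr (real DIM('a) - p)) has_derivative (\<lambda>h. GF x \<bullet> h)) (at x)"
proof (cases "norm x < r")
  case True
  then have "GF x = 0" using p_gt_1 by (simp add: GF_def near)
  moreover have "((\<lambda>x. \<bar>u x\<bar> powr p * norm x powr (real DIM('a) - p)) has_derivative (\<lambda>h. 0)) (at x)"
    by (rule has_derivative_transform_within_open[of "\<lambda>_. 0" _ _ _ "ball 0 r"])
      (use True near p_gt_1 in auto)
  ultimately show ?thesis by simp
next
  case False
  then have "x \<noteq> 0" using r by auto
  show ?thesis
    by (rule has_derivative_eq_rhs[OF has_derivative_mult[OF has_derivative_abs_powr_u has_derivative_norm_powr[OF \<open>x \<noteq> 0\<close>]]])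
      (auto simp: GF_def inner_add_left algebra_simps fun_eq_iff)
qed

section \<open>Continuity and integrability of the terms in the formula for \<open>D\<close>\<close>

lemma cont_sgn_powr_u: "continuous_on S (\<lambda>x. sgn (u x) * \<bar>u x\<bar> powr (p - 1))"
  using continuous_on_compose2[OF continuous_on_sgn_powr[of "p - 1"] continuous_on_subset[OF contu]]
    p_gt_1 by auto

lemma cont_abs_powr_u: "continuous_on S (\<lambda>x. \<bar>u x\<bar> powr p)"
  using p_gt_1 by (intro continuous_on_powr' continuous_intros continuous_on_subset[OF contu]) auto

lemma contGF: "continuous_on UNIV GF"
  unfolding GF_def
proof (rule continuous_on_UNIV_punctured[OF _ r])
  show "continuous_on (- {0}) (\<lambda>x. (p * (sgn (u x) * \<bar>u x\<bar> powr (p - 1)) * norm x powr (real DIM('a) - p)) *\<^sub>R G x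
    + ((real DIM('a) - p) * \<bar>u x\<bar> powr p * norm x powr (real DIM('a) - p - 2)) *\<^sub>R x)"
    by (intro continuous_intros cont_sgn_powr_u cont_abs_powr_u continuous_on_subset[OF contG]) auto
qed (use near p_gt_1 in auto)

lemma GF_near: "norm x < r \<Longrightarrow> GF x = 0" and GF_far: "norm x > M \<Longrightarrow> GF x = 0"
  using near far p_gt_1 by (auto simp: GF_def)

lemma cont_gradient_powr: "continuous_on UNIV (\<lambda>x. norm (G x) powr p)"
  using p_gt_1 by (intro continuous_on_powr' continuous_intros contG) auto

lemma integrable_gradient_powr: "integrable lborel (\<lambda>x. norm (G x) powr p)"
  by (rule integrable_lborel_bounded_support[OF cont_gradient_powr, of M]) (simp add: G_far)

lemma cont_hardy_potential: "continuous_on UNIV (\<lambda>x. \<bar>u x\<bar> powr p / norm x powr p)"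
  by (rule continuous_on_UNIV_punctured[OF _ r])
    (auto intro!: continuous_intros cont_abs_powr_u simp: near)

lemma integrable_hardy_potential: "integrable lborel (\<lambda>x. \<bar>u x\<bar> powr p / norm x powr p)"
  by (rule integrable_lborel_bounded_support[OF cont_hardy_potential, of M]) (simp add: far)

lemma cont_radial: "continuous_on UNIV (\<lambda>x. (GF x \<bullet> x) / norm x ^ DIM('a))"
  by (rule continuous_on_UNIV_punctured[OF _ r])
    (auto intro!: continuous_intros continuous_on_subset[OF contGF] simp: GF_near)

lemma integrable_radial: "integrable lborel (\<lambda>x. (GF x \<bullet> x) / norm x ^ DIM('a))"
  by (rule integrable_lborel_bounded_support[OF cont_radial, of M]) (simp add: GF_far)

text \<open>Taken with \<open>h = G x\<close>, this is the mixed term of \<open>D\<close>, brought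
  to the shape in which it occurs in the radial derivative of F.\<close>

lemma sgn_powr_A:
  assumes "x \<noteq> 0"
  shows "norm (A x) powr (p - 2) * (A x \<bullet> h)
    = \<alpha> powr (p - 1) * (sgn (u x) * \<bar>u x\<bar> powr (p - 1)) * (x \<bullet> h) / norm x powr p"
proof (cases "u x = 0")
  case False
  have A1: "norm (A x) powr (p - 2) = (\<alpha> powr p / \<alpha>\<^sup>2) * (\<bar>u x\<bar> powr p / \<bar>u x\<bar>\<^sup>2) / (norm x powr p / (norm x)\<^sup>2)"
    unfolding norm_A using assms False \<alpha>_pos
    by (simp add: powr_divide powr_mult powr_diff)
  have "u x = sgn (u x) * \<bar>u x\<bar>" by (simp add: sgn_mult_abs)
  then have A2: "A x \<bullet> h = \<alpha> * sgn (u x) * \<bar>u x\<bar> / (norm x)\<^sup>2 * (x \<bullet> h)"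
    unfolding A_def by (metis inner_scaleR_left mult.assoc)
  have "\<bar>u x\<bar> \<noteq> 0" using False by simp
  then show ?thesis
    unfolding A1 A2 using assms \<alpha>_pos
    by (simp add: powr_diff power2_eq_square field_simps del: abs_mult_self_eq)
qed (use p_gt_1 in \<open>simp add: A_def\<close>)

text \<open>In the notation of the proof, the radial term is p Y - p \<alpha> X. Eliminating the
  mixed term Y from the Bregman distance by means of it changes the coefficient of \<alpha>^p X from
  p - 1 to -1.\<close>

lemma D_eq:
  "D x = norm (G x) powr p - \<alpha> powr p * (\<bar>u x\<bar> powr p / norm x powr p)
    - \<alpha> powr (p - 1) * ((GF x \<bullet> x) / norm x ^ DIM('a))"
proof (cases "x = 0")
  case True
  then show ?thesis using r by (simp add: D_def bregman_def A_def G_near p_gt_1)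
next
  case False
  define X where "X = \<bar>u x\<bar> powr p / norm x powr p"
  define Y where "Y = (sgn (u x) * \<bar>u x\<bar> powr (p - 1)) * (x \<bullet> G x) / norm x powr p"
  have N: "norm x powr (real DIM('a) - p) / norm x ^ DIM('a) = 1 / norm x powr p"
    "norm x powr (real DIM('a) - p - 2) * (norm x)\<^sup>2 / norm x ^ DIM('a) = 1 / norm x powr p"
    using False by (simp_all add: powr_diff powr_realpow)
  have "(GF x \<bullet> x) / norm x ^ DIM('a)
      = p * (sgn (u x) * \<bar>u x\<bar> powr (p - 1)) * (x \<bullet> G x) * (norm x powr (real DIM('a) - p) / norm x ^ DIM('a))
      + (real DIM('a) - p) * \<bar>u x\<bar> powr p * (norm x powr (real DIM('a) - p - 2) * (norm x)\<^sup>2 / norm x ^ DIM('a))"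
    unfolding GF_def inner_add_left inner_scaleR_left power2_norm_eq_inner inner_commute[of "G x"]
    by (simp only: add_divide_distrib times_divide_eq_right mult.assoc mult.commute[of _ "x \<bullet> G x"])
  also have "\<dots> = p * Y - p * \<alpha> * X"
    unfolding N p_\<alpha> by (simp add: X_def Y_def algebra_simps diff_divide_distrib)
  finally have g: "(GF x \<bullet> x) / norm x ^ DIM('a) = p * Y - p * \<alpha> * X" .
  have a: "norm (A x) powr p = \<alpha> powr p * X"
    using \<alpha>_pos by (simp add: norm_A X_def powr_divide powr_mult)
  have al: "\<alpha> powr p = \<alpha> * \<alpha> powr (p - 1)"
    using \<alpha>_pos by (simp add: powr_diff)
  have "D x = norm (G x) powr p - p * (\<alpha> powr (p - 1) * Y) + (p - 1) * (\<alpha> powr p * X)"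
    unfolding D_def bregman_def a sgn_powr_A[OF False] by (simp add: Y_def)
  then show ?thesis
    unfolding g X_def[symmetric] al by (simp add: algebra_simps)
qed

text \<open>Read off from \<open>D_eq\<close>, whose terms are each continuous; the factor |A|^(p-2)
  in the definition can be singular at zeros of A when p < 2.\<close>

lemma contD: "continuous_on UNIV D"
  unfolding D_eq[abs_def]
  by (intro continuous_intros cont_gradient_powr cont_hardy_potential cont_radial)

lemma integrable_D: "integrable lborel D"
  unfolding D_eq[abs_def]
  by (intro Bochner_Integration.integrable_diff integrable_mult_right integrable_gradient_powr
      integrable_hardy_potential integrable_radial)

text \<open>The radial term of \<open>D_eq\<close> integrates to zero by the divergence identity for
  F.\<close>

lemma integral_D:
  "(\<integral>x. D x \<partial>lborel) = (\<integral>x. norm (G x) powr p \<partial>lborel)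
     - \<alpha> powr p * (\<integral>x. \<bar>u x\<bar> powr p / norm x powr p \<partial>lborel)"
proof -
  have "(\<integral>x. (GF x \<bullet> x) / norm x ^ DIM('a) \<partial>lborel) = 0"
    by (rule integral_radial_derivative_eq_0[OF has_derivative_F contGF r, of M])
      (use near far p_gt_1 in auto)
  then show ?thesis
    unfolding D_eq[abs_def]
    using integrable_gradient_powr integrable_hardy_potential integrable_radial
    by (simp only: Bochner_Integration.integral_diff Bochner_Integration.integrable_diff
        integrable_mult_right integral_mult_right_zero mult_zero_right diff_zero)
qed

end

section \<open>Averages over segments\<close>

text \<open>Hoelder's inequality against the constant 1, obtained by integrating a pointwise affine
  bound of h by h^p. If B = 0, then h vanishes almost everywhere.\<close>

lemma nn_integral_Jensen_powr:
  fixes h :: "'a \<Rightarrow> real"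
  assumes [measurable]: "h \<in> borel_measurable M" and h: "\<And>x. h x \<ge> 0"
    and space: "emeasure M (space M) = ennreal \<sigma>" and \<sigma>: "\<sigma> > 0" and p: "p > 1"
    and B: "(\<integral>\<^sup>+x. ennreal (h x powr p) \<partial>M) \<le> ennreal B" "B \<ge> 0"
  shows "(\<integral>\<^sup>+x. ennreal (h x) \<partial>M) \<le> ennreal (\<sigma> powr (1 - 1 / p) * B powr (1 / p))"
proof (cases "B = 0")
  case True
  then have "(\<integral>\<^sup>+x. ennreal (h x powr p) \<partial>M) = 0" using B by simp
  then have "AE x in M. ennreal (h x powr p) = 0" by (subst (asm) nn_integral_0_iff_AE) auto
  then have "AE x in M. ennreal (h x) = 0"
    by eventually_elim (simp add: ennreal_eq_zero_iff)
  then have "(\<integral>\<^sup>+x. ennreal (h x) \<partial>M) = 0" by (subst nn_integral_0_iff_AE) auto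
  then show ?thesis by simp
next
  case False
  then have Bpos: "B > 0" using B by simp
  \<comment> \<open>The equality case: the constant function c on a space of mass \<sigma> has
    integral of c^p equal to B. Dividing the tangent inequality at c by p c^(p-1) gives the
    coefficients \<open>a\<close> and \<open>b\<close>.\<close>
  define c where "c = (B / \<sigma>) powr (1 / p)"
  have c: "c > 0" using Bpos \<sigma> by (simp add: c_def)
  have cp: "c powr p = B / \<sigma>" using Bpos \<sigma> p by (simp add: c_def powr_powr)
  have cc: "c powr (p - 1) = B / \<sigma> / c" using c by (simp add: powr_diff cp)
  define a where "a = c * \<sigma> / (p * B)"
  define b where "b = (p - 1) * c / p"
  have ab: "a \<ge> 0" "b \<ge> 0" using Bpos \<sigma> c p by (auto simp: a_def b_def)
  have le: "h x \<le> a * h x powr p + b" for x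
  proof -
    have "p * (h x * c powr (p - 1)) \<le> h x powr p + (p - 1) * c powr p"
      using Young_tangent[OF p h[of x], of c] c by simp
    then have "a * (p * (h x * c powr (p - 1))) \<le> a * (h x powr p + (p - 1) * c powr p)"
      using ab by (intro mult_left_mono)
    moreover have "a * (p * (h x * c powr (p - 1))) = h x"
      unfolding cc a_def using Bpos \<sigma> c p by simp
    moreover have "a * ((p - 1) * c powr p) = b"
      unfolding cp a_def b_def using Bpos \<sigma> c p by simp
    ultimately show ?thesis by (simp add: distrib_left)
  qed
  have "(\<integral>\<^sup>+x. ennreal (h x) \<partial>M) \<le> (\<integral>\<^sup>+x. ennreal a * ennreal (h x powr p) + ennreal b \<partial>M)"
    using le ab by (intro nn_integral_mono) (simp flip: ennreal_mult ennreal_plus add: ennreal_leI)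
  also have "\<dots> = ennreal a * (\<integral>\<^sup>+x. ennreal (h x powr p) \<partial>M) + ennreal b * ennreal \<sigma>"
    by (simp add: nn_integral_add nn_integral_cmult space)
  also have "\<dots> \<le> ennreal a * ennreal B + ennreal b * ennreal \<sigma>"
    by (intro add_right_mono mult_left_mono B) auto
  also have "\<dots> = ennreal (a * B + b * \<sigma>)"
    using ab B \<sigma> by (simp flip: ennreal_mult ennreal_plus)
  also have "a * B + b * \<sigma> = \<sigma> * c"
    unfolding a_def b_def using Bpos \<sigma> p by (simp add: field_simps)
  also have "\<dots> = \<sigma> powr (1 - 1 / p) * B powr (1 / p)"
    using Bpos \<sigma> by (simp add: c_def powr_divide powr_diff)
  finally show ?thesis .
qed

text \<open>Morrey's argument: for each \<open>t\<close>, Hoelder in \<open>y\<close> and the dilation \<open>z = x + t (y - x)\<close> cost a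
  factor \<open>t powr (- n / p)\<close>, which is integrable over \<open>{0..1}\<close> because \<open>p > n\<close>.\<close>

lemma average_segment_integral_bound:
  fixes g :: "'a::euclidean_space \<Rightarrow> real" and x :: 'a
  assumes [measurable]: "g \<in> borel_measurable borel" "S \<in> sets borel" and g: "\<And>z. g z \<ge> 0"
    and p: "p > real DIM('a)" and K: "(\<integral>\<^sup>+z. ennreal (g z powr p) \<partial>lborel) \<le> ennreal K" "K \<ge> 0"
    and \<sigma>: "emeasure lborel S = ennreal \<sigma>" "\<sigma> > 0" and m: "m \<ge> 0"
    and seg: "\<And>y. y \<in> S \<Longrightarrow>
      ennreal m \<le> (\<integral>\<^sup>+t. ennreal (g (x + t *\<^sub>R (y - x))) * indicator {0..1} t \<partial>lborel)"
  shows "m \<le> p / (p - real DIM('a)) * \<sigma> powr (- 1 / p) * K powr (1 / p)"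
proof -
  define n where "n = DIM('a)"
  have p1: "p > 1" using p DIM_positive[where 'a='a] by linarith
  have np: "real n / p < 1" using p p1 by (simp add: n_def)
  define c where "c = \<sigma> powr (1 - 1 / p) * K powr (1 / p)"
  have c: "c \<ge> 0" by (simp add: c_def)
  have slice: "(\<integral>\<^sup>+y. ennreal (g (x + t *\<^sub>R (y - x))) * indicator S y \<partial>lborel)
      \<le> ennreal (c * t powr (- (real n / p)))" if t: "t > 0" for t
  proof -
    have "(\<integral>\<^sup>+y. ennreal (g (x + t *\<^sub>R (y - x)) powr p) \<partial>lborel)
        = (\<integral>\<^sup>+y. ennreal (g ((x - t *\<^sub>R x) + t *\<^sub>R y) powr p) \<partial>lborel)"
      by (simp add: algebra_simps)
    moreover have "(\<integral>\<^sup>+z. ennreal (g z powr p) \<partial>lborel)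
        = ennreal (\<bar>t\<bar> ^ n) * (\<integral>\<^sup>+y. ennreal (g ((x - t *\<^sub>R x) + t *\<^sub>R y) powr p) \<partial>lborel)"
      unfolding n_def using t by (intro nn_integral_lborel_affine) auto
    ultimately have "ennreal (t ^ n) * (\<integral>\<^sup>+y. ennreal (g (x + t *\<^sub>R (y - x)) powr p) \<partial>lborel) \<le> ennreal K"
      using K t by simp
    then have "ennreal (inverse (t ^ n)) * (ennreal (t ^ n) * (\<integral>\<^sup>+y. ennreal (g (x + t *\<^sub>R (y - x)) powr p) \<partial>lborel))
        \<le> ennreal (inverse (t ^ n)) * ennreal K"
      by (rule mult_left_mono) simp
    moreover have "ennreal (inverse (t ^ n)) * ennreal (t ^ n) = 1"
      using t by (simp flip: ennreal_mult)
    ultimately have "(\<integral>\<^sup>+y. ennreal (g (x + t *\<^sub>R (y - x)) powr p) \<partial>lborel) \<le> ennreal (K / t ^ n)"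
      using t K by (simp flip: mult.assoc ennreal_mult add: divide_inverse mult.commute)
    moreover have "(\<integral>\<^sup>+y. ennreal (g (x + t *\<^sub>R (y - x)) powr p) \<partial>restrict_space lborel S)
        \<le> (\<integral>\<^sup>+y. ennreal (g (x + t *\<^sub>R (y - x)) powr p) \<partial>lborel)"
      by (subst nn_integral_restrict_space) (auto intro!: nn_integral_mono simp: indicator_def)
    ultimately have "(\<integral>\<^sup>+y. ennreal (g (x + t *\<^sub>R (y - x)) powr p) \<partial>restrict_space lborel S) \<le> ennreal (K / t ^ n)"
      by (rule order_trans[rotated])
    moreover have "emeasure (restrict_space lborel S) (space (restrict_space lborel S)) = ennreal \<sigma>"
      by (simp add: space_restrict_space emeasure_restrict_space \<sigma>)
    moreover have "(\<lambda>y. g (x + t *\<^sub>R (y - x))) \<in> borel_measurable (restrict_space lborel S)"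
      by (intro measurable_restrict_space1) measurable
    ultimately have "(\<integral>\<^sup>+y. ennreal (g (x + t *\<^sub>R (y - x))) \<partial>restrict_space lborel S)
        \<le> ennreal (\<sigma> powr (1 - 1 / p) * (K / t ^ n) powr (1 / p))"
      using g \<sigma> p1 K t by (intro nn_integral_Jensen_powr) auto
    also have "(K / t ^ n) powr (1 / p) = K powr (1 / p) * t powr (- (real n / p))"
      using t by (simp add: powr_divide powr_powr powr_minus_divide flip: powr_realpow)
    finally show ?thesis
      by (simp add: nn_integral_restrict_space c_def mult.assoc)
  qed
  \<comment> \<open>Integrating the hypothesis \<open>seg\<close> over S produces m \<sigma>;
    exchanging the integrals then makes the bound \<open>slice\<close> for fixed t
    applicable.\<close>
  have "ennreal (m * \<sigma>) = (\<integral>\<^sup>+y. ennreal m * indicator S y \<partial>lborel)"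
    using m \<sigma> by (simp add: nn_integral_cmult ennreal_mult)
  also have "\<dots> \<le> (\<integral>\<^sup>+y. (\<integral>\<^sup>+t. ennreal (g (x + t *\<^sub>R (y - x))) * indicator {0..1} t * indicator S y \<partial>lborel) \<partial>lborel)"
    using seg by (intro nn_integral_mono) (auto simp: nn_integral_multc split: split_indicator)
  also have "\<dots> = (\<integral>\<^sup>+t. (\<integral>\<^sup>+y. ennreal (g (x + t *\<^sub>R (y - x))) * indicator {0..1} t * indicator S y \<partial>lborel) \<partial>lborel)"
    by (rule lborel_pair.Fubini') measurable
  also have "\<dots> = (\<integral>\<^sup>+t. (\<integral>\<^sup>+y. ennreal (g (x + t *\<^sub>R (y - x))) * indicator S y \<partial>lborel) * indicator {0..1} t \<partial>lborel)"
  proof (rule nn_integral_cong)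
    fix t :: real
    have "(\<integral>\<^sup>+y. ennreal (g (x + t *\<^sub>R (y - x))) * indicator {0..1} t * indicator S y \<partial>lborel)
        = (\<integral>\<^sup>+y. ennreal (g (x + t *\<^sub>R (y - x))) * indicator S y * indicator {0..1} t \<partial>lborel)"
      by (simp only: mult.assoc mult.commute[of "indicator {0..1} t"])
    also have "\<dots> = (\<integral>\<^sup>+y. ennreal (g (x + t *\<^sub>R (y - x))) * indicator S y \<partial>lborel) * indicator {0..1} t"
      by (rule nn_integral_multc) measurable
    finally show "(\<integral>\<^sup>+y. ennreal (g (x + t *\<^sub>R (y - x))) * indicator {0..1} t * indicator S y \<partial>lborel) = \<dots>" .
  qed
  also have "\<dots> \<le> (\<integral>\<^sup>+t. ennreal (c * t powr (- (real n / p))) * indicator {0..1} t \<partial>lborel)"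
  proof (rule nn_integral_mono_AE)
    \<comment> \<open>The dilation degenerates at t = 0, so \<open>slice\<close> covers only t > 0;
      the single point is a null set.\<close>
    show "AE t in lborel. (\<integral>\<^sup>+y. ennreal (g (x + t *\<^sub>R (y - x))) * indicator S y \<partial>lborel) * indicator {0..1} t
        \<le> ennreal (c * t powr (- (real n / p))) * indicator {0..1} t"
      using AE_lborel_singleton[of "0::real"]
    proof eventually_elim
      case (elim t)
      then show ?case
        using slice[of t] by (cases "t \<in> {0..1}") auto
    qed
  qed
  also have "\<dots> = ennreal (c * (1 / (1 - real n / p)))"
  proof (rule nn_integral_has_integral_lebesgue')
    show "((\<lambda>t. c * t powr (- (real n / p))) has_integral c * (1 / (1 - real n / p))) {0..1}"
      using has_integral_mult_right[OF has_integral_powr_from_0[of "- (real n / p)" 1]] np by simp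
  qed (use c in auto)
  finally have "m * \<sigma> \<le> c * (1 / (1 - real n / p))"
    using c np by (subst (asm) ennreal_le_iff) auto
  also have "1 / (1 - real n / p) = p / (p - real n)"
    using p1 by (simp add: field_simps)
  finally have "m \<le> c * (p / (p - real n)) / \<sigma>"
    using \<sigma>(2) by (simp only: pos_le_divide_eq)
  also have "\<dots> = p / (p - real n) * (\<sigma> powr (1 - 1 / p) / \<sigma>) * K powr (1 / p)"
    by (simp add: c_def)
  also have "\<sigma> powr (1 - 1 / p) / \<sigma> = \<sigma> powr (- 1 / p)"
    using \<sigma> by (simp add: powr_diff powr_minus_divide)
  finally show ?thesis by (simp add: n_def)
qed

text \<open>Since \<phi> vanishes at 1, its value at 0 is the integral of -\<phi>', which
  \<open>b\<close> dominates.\<close>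

lemma nn_integral_ge_of_derivative_bound:
  fixes \<phi> :: "real \<Rightarrow> real"
  assumes der: "\<And>t. t \<in> {0..1} \<Longrightarrow> (\<phi> has_real_derivative \<phi>' t) (at t)" and "\<phi> 1 = 0"
    and cont: "continuous_on {0..1} b" and b: "\<And>t. t \<in> {0..1} \<Longrightarrow> - \<phi>' t \<le> b t"
    and nonneg: "\<And>t. t \<in> {0..1} \<Longrightarrow> 0 \<le> b t"
  shows "ennreal (\<phi> 0) \<le> (\<integral>\<^sup>+t. ennreal (b t) * indicator {0..1} t \<partial>lborel)"
proof -
  have "(\<phi>' has_integral (\<phi> 1 - \<phi> 0)) {0..1}"
    using der by (intro fundamental_theorem_of_calculus)
      (auto simp flip: has_real_derivative_iff_has_vector_derivative intro: has_field_derivative_at_within)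
  then have 1: "((\<lambda>t. - \<phi>' t) has_integral \<phi> 0) {0..1}"
    by (rule has_integral_neg[THEN has_integral_eq_rhs]) (simp add: \<open>\<phi> 1 = 0\<close>)
  have 2: "(b has_integral integral {0..1} b) {0..1}"
    using cont by (intro integrable_integral integrable_continuous_interval)
  have "\<phi> 0 \<le> integral {0..1} b"
    using has_integral_le[OF 1 2] b by auto
  moreover have "(\<integral>\<^sup>+t. ennreal (b t) * indicator {0..1} t \<partial>lborel) = ennreal (integral {0..1} b)"
    using nonneg 2 by (rule nn_integral_has_integral_lebesgue')
  ultimately show ?thesis by (simp add: ennreal_leI)
qed

text \<open>Identifies a one-dimensional Euclidean space with the real line; Lebesgue measure is
  characterised by its values on boxes, which here correspond to intervals.\<close>

lemma distr_lborel_scaleR_Basis: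
  assumes k: "(Basis :: 'a::euclidean_space set) = {k}"
  shows "distr lborel borel (\<lambda>s::real. s *\<^sub>R k) = (lborel :: 'a measure)"
proof (rule lborel_eqI[symmetric])
  fix l u :: 'a
  assume "\<And>b. b \<in> Basis \<Longrightarrow> l \<bullet> b \<le> u \<bullet> b"
  then have "l \<bullet> k \<le> u \<bullet> k" by (simp add: k)
  moreover have "k \<in> Basis" by (simp add: k)
  then have "k \<bullet> k = 1" by (rule inner_same_Basis)
  then have "(\<lambda>s. s *\<^sub>R k) -` box l u = {l \<bullet> k<..<u \<bullet> k}"
    by (auto simp: box_def k)
  ultimately show "emeasure (distr lborel borel (\<lambda>s. s *\<^sub>R k)) (box l u) = ennreal (\<Prod>b\<in>Basis. (u - l) \<bullet> b)"
    by (simp add: emeasure_distr k inner_diff_left)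
qed simp

text \<open>In dimension one, t \<mapsto> x + t w parametrises the whole line with Jacobian |w| if w
  \<noteq> 0, and the segment is a part of it.\<close>

lemma nn_integral_segment_le_dim_1:
  fixes g :: "'a::euclidean_space \<Rightarrow> ennreal" and x w :: 'a
  assumes dim: "DIM('a) = 1" and [measurable]: "g \<in> borel_measurable borel"
  shows "ennreal (norm w) * (\<integral>\<^sup>+t. g (x + t *\<^sub>R w) * indicator {0..1} t \<partial>lborel) \<le> (\<integral>\<^sup>+z. g z \<partial>lborel)"
proof (cases "w = 0")
  case False
  obtain k :: 'a where k: "Basis = {k}" using dim card_1_singletonE by blast
  have kk: "norm k = 1" by (rule norm_Basis) (simp add: k)
  have rep: "(z \<bullet> k) *\<^sub>R k = z" for z :: 'a
    using euclidean_representation[of z] by (simp add: k)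
  have nw: "norm w = \<bar>w \<bullet> k\<bar>"
    using rep[of w] kk by (metis norm_scaleR mult.right_neutral)
  have w0: "w \<bullet> k \<noteq> 0"
    using rep[of w] False by (metis scaleR_zero_left)
  have "(\<integral>\<^sup>+z. g z \<partial>lborel) = (\<integral>\<^sup>+s. g (s *\<^sub>R k) \<partial>lborel)"
    unfolding distr_lborel_scaleR_Basis[OF k, symmetric] by (rule nn_integral_distr) auto
  also have "\<dots> = ennreal (norm w) * (\<integral>\<^sup>+t. g ((x \<bullet> k + t * (w \<bullet> k)) *\<^sub>R k) \<partial>lborel)"
    using nn_integral_lborel_affine[OF w0, of "\<lambda>s. g (s *\<^sub>R k)" "x \<bullet> k"] by (simp add: nw mult.commute)
  also have "(\<lambda>t. g ((x \<bullet> k + t * (w \<bullet> k)) *\<^sub>R k)) = (\<lambda>t. g (x + t *\<^sub>R w))"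
    using rep[of x] rep[of w] by (simp add: scaleR_add_left flip: scaleR_scaleR)
  finally show ?thesis
    by (auto intro!: mult_left_mono nn_integral_mono split: split_indicator)
qed simp

section \<open>The pointwise bounds\<close>

context punctured_test_function
begin

lemma nn_integral_D: "(\<integral>\<^sup>+x. ennreal (D x) \<partial>lborel) = ennreal (\<integral>x. D x \<partial>lborel)"
  using integrable_D D_nonneg by (intro nn_integral_eq_integral) auto

lemma integral_D_nonneg: "0 \<le> (\<integral>x. D x \<partial>lborel)"
  using D_nonneg by (intro Bochner_Integration.integral_nonneg) auto

text \<open>Differentiating the weight contributes -\<alpha> |x|^(-\<alpha>-2) x u, which is exactly
  -|x|^(-\<alpha>) A.\<close>

lemma has_derivative_ground_state_quotient:
  assumes "x \<noteq> 0"
  shows "((\<lambda>x. norm x powr (- \<alpha>) * u x) has_derivative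
    (\<lambda>h. norm x powr (- \<alpha>) * ((G x - A x) \<bullet> h))) (at x)"
proof (rule has_derivative_eq_rhs[OF has_derivative_mult[OF has_derivative_norm_powr[OF assms] der]])
  have "norm x powr (- \<alpha> - 2) = norm x powr (- \<alpha>) / (norm x)\<^sup>2"
    using assms by (simp add: powr_diff)
  then show "(\<lambda>h. norm x powr - \<alpha> * (G x \<bullet> h) + - \<alpha> * norm x powr (- \<alpha> - 2) * (x \<bullet> h) * u x)
      = (\<lambda>h. norm x powr (- \<alpha>) * ((G x - A x) \<bullet> h))"
    by (auto simp: fun_eq_iff A_def inner_diff_left algebra_simps)
qed

text \<open>Along a segment on which \<open>|z|\<close> never drops below \<open>|x|\<close>, the weight \<open>(|x| / |z|) powr \<alpha>\<close>
  of the ground state substitution is at most 1.\<close>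

lemma segment_integral_bound_outward:
  assumes x: "x \<noteq> 0" and out: "x \<bullet> (y - x) \<ge> 0" and y: "u y = 0" and \<rho>: "norm (y - x) \<le> \<rho>"
  shows "ennreal \<bar>u x\<bar>
    \<le> (\<integral>\<^sup>+t. ennreal (\<rho> * norm (G (x + t *\<^sub>R (y - x)) - A (x + t *\<^sub>R (y - x)))) * indicator {0..1} t \<partial>lborel)"
proof -
  define z where "z t = x + t *\<^sub>R (y - x)" for t
  \<comment> \<open>Normalised so that \<open>\<phi> 0 = \<bar>u x\<bar>\<close> and
    \<open>\<phi> 1 = 0\<close>: the sign makes the initial value nonnegative, and |x|^\<alpha>
    cancels the weight at the starting point.\<close>
  define \<phi> where "\<phi> t = sgn (u x) * norm x powr \<alpha> * (norm (z t) powr (- \<alpha>) * u (z t))" for t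
  have z: "norm x \<le> norm (z t)" if "t \<ge> 0" for t
  proof -
    have "(norm x)\<^sup>2 \<le> x \<bullet> z t"
      using out that by (simp add: z_def inner_add_right power2_norm_eq_inner)
    also have "\<dots> \<le> norm x * norm (z t)" by (rule norm_cauchy_schwarz)
    finally show ?thesis using x by (simp add: power2_eq_square)
  qed
  have \<rho>0: "\<rho> \<ge> 0" using \<rho> norm_ge_zero order_trans by blast
  have "ennreal (\<phi> 0) \<le> (\<integral>\<^sup>+t. ennreal (\<rho> * norm (G (z t) - A (z t))) * indicator {0..1} t \<partial>lborel)"
  proof (rule nn_integral_ge_of_derivative_bound)
    fix t :: real assume t: "t \<in> {0..1}"
    then have zt: "norm x \<le> norm (z t)" "z t \<noteq> 0" using z[of t] x by auto
    have "(z has_derivative (\<lambda>h. h *\<^sub>R (y - x))) (at t)"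
      unfolding z_def by (auto intro!: derivative_eq_intros)
    from has_derivative_compose[OF this has_derivative_ground_state_quotient[OF zt(2)]]
    have "((\<lambda>t. norm (z t) powr (- \<alpha>) * u (z t)) has_real_derivative
        norm (z t) powr (- \<alpha>) * ((G (z t) - A (z t)) \<bullet> (y - x))) (at t)"
      by (rule has_derivative_imp_has_field_derivative) simp
    then show "(\<phi> has_real_derivative sgn (u x) * norm x powr \<alpha> *
        (norm (z t) powr (- \<alpha>) * ((G (z t) - A (z t)) \<bullet> (y - x)))) (at t)"
      unfolding \<phi>_def by (rule DERIV_cmult)
    have "norm x powr \<alpha> * norm (z t) powr (- \<alpha>) = (norm x / norm (z t)) powr \<alpha>"
      using x zt by (simp add: powr_divide powr_minus_divide)
    also have "\<dots> \<le> 1"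
      using zt \<alpha>_pos x by (intro powr_le1) auto
    finally have weight: "norm x powr \<alpha> * norm (z t) powr (- \<alpha>) \<le> 1" .
    have "\<bar>sgn (u x) * norm x powr \<alpha> * (norm (z t) powr (- \<alpha>) * ((G (z t) - A (z t)) \<bullet> (y - x)))\<bar>
        = \<bar>sgn (u x)\<bar> * (norm x powr \<alpha> * norm (z t) powr (- \<alpha>)) * \<bar>(G (z t) - A (z t)) \<bullet> (y - x)\<bar>"
      by (simp add: abs_mult)
    also have "\<dots> \<le> 1 * 1 * (norm (G (z t) - A (z t)) * norm (y - x))"
      using weight by (intro mult_mono Cauchy_Schwarz_ineq2) (auto simp: sgn_if)
    also have "\<dots> \<le> \<rho> * norm (G (z t) - A (z t))"
      using \<rho> by (simp add: mult.commute[of \<rho>] mult_left_mono)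
    finally show "- (sgn (u x) * norm x powr \<alpha> * (norm (z t) powr (- \<alpha>) * ((G (z t) - A (z t)) \<bullet> (y - x))))
        \<le> \<rho> * norm (G (z t) - A (z t))" by linarith
  next
    have zc: "continuous_on {0..1} z" unfolding z_def by (intro continuous_intros)
    show "continuous_on {0..1} (\<lambda>t. \<rho> * norm (G (z t) - A (z t)))"
      by (intro continuous_intros continuous_on_compose2[OF contG zc] continuous_on_compose2[OF contA zc]) auto
  qed (use y \<rho>0 in \<open>auto simp: \<phi>_def z_def\<close>)
  moreover have "norm x powr \<alpha> * norm x powr (- \<alpha>) = 1"
    using x by (simp flip: powr_add)
  then have "\<phi> 0 = \<bar>u x\<bar>"
    by (simp add: \<phi>_def z_def abs_sgn mult.assoc mult.commute[of "sgn _"] mult.left_commute)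
  ultimately show ?thesis by (simp add: z_def)
qed

text \<open>The cube extends from its corner x in each coordinate towards the sign of x . i, so
  every summand of x . (y - x) is nonnegative. The length bound comes from the sum of the
  coordinates.\<close>

lemma outward_cbox_exists:
  fixes x :: 'a
  assumes R: "R \<ge> 0"
  obtains a b :: 'a where "emeasure lborel (cbox a b) = ennreal (R ^ DIM('a))"
    and "\<And>y. y \<in> cbox a b \<Longrightarrow> x \<bullet> (y - x) \<ge> 0 \<and> norm (y - x) \<le> real DIM('a) * R"
proof
  define s :: "'a \<Rightarrow> real" where "s i = (if x \<bullet> i \<ge> 0 then 1 else - 1)" for i
  define a where "a = (\<Sum>i\<in>Basis. (x \<bullet> i + min 0 (s i * R)) *\<^sub>R i)"
  define b where "b = (\<Sum>i\<in>Basis. (x \<bullet> i + max 0 (s i * R)) *\<^sub>R i)"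
  have ai: "a \<bullet> i = x \<bullet> i + min 0 (s i * R)" and bi: "b \<bullet> i = x \<bullet> i + max 0 (s i * R)"
    if "i \<in> Basis" for i
    using that by (simp_all add: a_def b_def inner_sum_left_Basis)
  have "(b - a) \<bullet> i = R" if "i \<in> Basis" for i
    using that R by (simp add: inner_diff_left ai bi s_def)
  then show "emeasure lborel (cbox a b) = ennreal (R ^ DIM('a))"
    using R by (subst emeasure_lborel_cbox) (auto simp: ai bi)
  fix y assume "y \<in> cbox a b"
  then have y: "a \<bullet> i \<le> y \<bullet> i" "y \<bullet> i \<le> b \<bullet> i" if "i \<in> Basis" for i
    using that by (auto simp: mem_box)
  have i: "(x \<bullet> i) * ((y - x) \<bullet> i) \<ge> 0 \<and> \<bar>(y - x) \<bullet> i\<bar> \<le> R" if "i \<in> Basis" for i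
    using y[OF that] R unfolding ai[OF that] bi[OF that]
    by (auto simp: s_def inner_diff_left zero_le_mult_iff split: if_splits)
  have "x \<bullet> (y - x) \<ge> 0"
    by (subst euclidean_inner) (intro sum_nonneg, use i in auto)
  moreover have "norm (y - x) \<le> (\<Sum>i\<in>Basis. \<bar>(y - x) \<bullet> i\<bar>)" by (rule norm_le_l1)
  moreover have "\<dots> \<le> real DIM('a) * R"
    using i by (intro sum_bounded_above) auto
  ultimately show "x \<bullet> (y - x) \<ge> 0 \<and> norm (y - x) \<le> real DIM('a) * R" by linarith
qed

text \<open>In the constant, n 2^(1/n) comes from the length bound for segments in a cube of volume
  2 L, 2^((p-1)/p) from \<open>bregman_lower_bound\<close>, and 1 / \<alpha> from the integral of
  t^(-n/p).\<close>

lemma abs_u_le_of_p_ge_2: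
  assumes p2: "p \<ge> 2" and "open \<Omega>" and out: "\<And>y. y \<notin> \<Omega> \<Longrightarrow> u y = 0"
    and L: "emeasure lborel \<Omega> = ennreal L" "L > 0"
  shows "\<bar>u x\<bar> \<le> (real DIM('a) * 2 powr (1 / real DIM('a)) * 2 powr ((p - 1) / p) / \<alpha>)
    * L powr (1 / real DIM('a) - 1 / p) * (\<integral>x. D x \<partial>lborel) powr (1 / p)"
proof (cases "u x = 0")
  case False
  define n where "n = real DIM('a)"
  define I where "I = (\<integral>x. D x \<partial>lborel)"
  define R where "R = (2 * L) powr (1 / n)"
  have n: "n > 0" by (simp add: n_def)
  have R: "R > 0" using L by (simp add: R_def)
  have RL: "R ^ DIM('a) = 2 * L"
    using L by (simp add: R_def n_def powr_powr flip: powr_realpow)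
  have x: "x \<noteq> 0" using False near[of 0] r by auto
  have I: "I \<ge> 0" unfolding I_def by (rule integral_D_nonneg)
  obtain a b :: 'a where ab: "emeasure lborel (cbox a b) = ennreal (2 * L)"
    "\<And>y. y \<in> cbox a b \<Longrightarrow> x \<bullet> (y - x) \<ge> 0 \<and> norm (y - x) \<le> n * R"
    using outward_cbox_exists[of R x] R unfolding RL n_def by auto
  define S where "S = cbox a b - \<Omega>"
  have [measurable]: "\<Omega> \<in> sets borel" "S \<in> sets borel"
    using \<open>open \<Omega>\<close> by (auto simp: S_def)
  define \<sigma> where "\<sigma> = measure lborel S"
  have "emeasure lborel S \<le> emeasure lborel (cbox a b)"
    by (intro emeasure_mono) (auto simp: S_def)
  then have \<sigma>: "emeasure lborel S = ennreal \<sigma>"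
    unfolding \<sigma>_def ab by (intro emeasure_eq_ennreal_measure) (auto simp: top_unique)
  have "emeasure lborel (cbox a b) \<le> emeasure lborel (S \<union> \<Omega>)"
    by (intro emeasure_mono) (auto simp: S_def)
  also have "\<dots> \<le> emeasure lborel S + emeasure lborel \<Omega>"
    by (intro emeasure_subadditive) auto
  also have "\<dots> = ennreal (\<sigma> + L)"
    using L by (simp add: \<sigma> \<sigma>_def)
  finally have \<sigma>L: "\<sigma> \<ge> L"
    unfolding ab using L by (subst (asm) ennreal_le_iff) (auto simp: \<sigma>_def)
  \<comment> \<open>The segment length bound n R is part of the integrand, hence its p-th power
    here; 2^(p-1) inverts the constant in \<open>bregman_lower_bound\<close>.\<close>
  define K where "K = (n * R) powr p * (2 powr (p - 1) * I)"
  have "(\<integral>\<^sup>+z. ennreal ((n * R * norm (G z - A z)) powr p) \<partial>lborel)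
      \<le> (\<integral>\<^sup>+z. ennreal ((n * R) powr p * 2 powr (p - 1)) * ennreal (D z) \<partial>lborel)"
  proof (rule nn_integral_mono)
    fix z
    have "2 powr (p - 1) * (2 powr (1 - p) * norm (G z - A z) powr p) \<le> 2 powr (p - 1) * D z"
      unfolding D_def using p2 by (intro mult_left_mono bregman_lower_bound) auto
    then have "norm (G z - A z) powr p \<le> 2 powr (p - 1) * D z"
      by (simp add: mult.assoc[symmetric] flip: powr_add)
    then have "(n * R) powr p * norm (G z - A z) powr p \<le> (n * R) powr p * (2 powr (p - 1) * D z)"
      by (intro mult_left_mono) auto
    then show "ennreal ((n * R * norm (G z - A z)) powr p)
        \<le> ennreal ((n * R) powr p * 2 powr (p - 1)) * ennreal (D z)"
      using D_nonneg by (simp add: powr_mult mult.assoc ennreal_leI flip: ennreal_mult)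
  qed
  also have "\<dots> = ennreal ((n * R) powr p * 2 powr (p - 1)) * ennreal I"
    using borel_measurable_continuous_onI[OF contD]
    by (simp add: nn_integral_cmult nn_integral_D I_def)
  also have "\<dots> = ennreal K"
    using I by (simp add: K_def mult.assoc flip: ennreal_mult)
  finally have K: "(\<integral>\<^sup>+z. ennreal ((n * R * norm (G z - A z)) powr p) \<partial>lborel) \<le> ennreal K" .
  have "\<bar>u x\<bar> \<le> p / (p - real DIM('a)) * \<sigma> powr (- 1 / p) * K powr (1 / p)"
  proof (rule average_segment_integral_bound[where x=x, OF _ _ _ p K _ \<sigma>])
    show "(\<lambda>z. n * R * norm (G z - A z)) \<in> borel_measurable borel"
      by (intro borel_measurable_continuous_onI continuous_intros contG contA)
    fix y assume "y \<in> S"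
    then show "ennreal \<bar>u x\<bar> \<le> (\<integral>\<^sup>+t. ennreal (n * R * norm (G (x + t *\<^sub>R (y - x)) - A (x + t *\<^sub>R (y - x))))
        * indicator {0..1} t \<partial>lborel)"
      using ab(2)[of y] out by (intro segment_integral_bound_outward x) (auto simp: S_def)
  qed (use n R I L \<sigma>L in \<open>auto simp: K_def\<close>)
  also have "p / (p - real DIM('a)) = 1 / \<alpha>" by (simp add: \<alpha>_def)
  also have "K powr (1 / p) = n * R * (2 powr ((p - 1) / p) * I powr (1 / p))"
    using n R I p_gt_1 by (simp add: K_def powr_mult powr_powr)
  \<comment> \<open>The exponent -1 / p is negative, so the lower bound \<sigma> \<ge> L gives an
    upper bound; L^(-1/p) then combines with the factor L^(1/n) contained in R.\<close>
  also have "1 / \<alpha> * \<sigma> powr (- 1 / p) * (n * R * (2 powr ((p - 1) / p) * I powr (1 / p)))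
      \<le> 1 / \<alpha> * L powr (- 1 / p) * (n * R * (2 powr ((p - 1) / p) * I powr (1 / p)))"
    using \<alpha>_pos n R L \<sigma>L p_gt_1
    by (intro mult_right_mono mult_left_mono powr_mono2') (auto intro!: mult_nonneg_nonneg)
  also have "\<dots> = (n * 2 powr (1 / n) * 2 powr ((p - 1) / p) / \<alpha>) * L powr (1 / n - 1 / p) * I powr (1 / p)"
    using L by (simp add: R_def powr_mult powr_diff powr_minus_divide)
  finally show ?thesis by (simp add: n_def I_def)
qed (use \<alpha>_pos in simp)

text \<open>The potential \<open>(\<alpha> / |x|) powr (p - 1)\<close> solves a Riccati equation, and lowering it by a constant
  \<open>\<kappa>\<close> leaves a subsolution; the constant survives as a boundary term.\<close>

lemma D_ge_derivative:
  assumes x: "x \<noteq> 0" and \<kappa>: "0 \<le> \<kappa>" "\<kappa> \<le> (\<alpha> / norm x) powr (p - 1)"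
  shows "- (\<kappa> * (p * (sgn (u x) * \<bar>u x\<bar> powr (p - 1)) * (G x \<bullet> x))) \<le> norm x * D x"
proof -
  define h where "h = (\<alpha> / norm x) powr (p - 1)"
  \<comment> \<open>Chosen so that c^(p-1) = (h - \<kappa>) |u|^(p-1): Young's inequality at c
    yields the lowered potential, and c \<le> |A| because \<kappa> \<ge> 0.\<close>
  define c where "c = (h - \<kappa>) powr (1 / (p - 1)) * \<bar>u x\<bar>"
  define s where "s = sgn (u x) * (x \<bullet> G x)"
  have N: "norm x > 0" using x by simp
  have "(h - \<kappa>) powr (1 / (p - 1)) \<le> h powr (1 / (p - 1))"
    using \<kappa> p_gt_1 by (intro powr_mono2) (auto simp: h_def)
  also have "\<dots> = \<alpha> / norm x"
    using p_gt_1 \<alpha>_pos N by (simp add: h_def powr_powr)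
  finally have "c \<le> \<alpha> / norm x * \<bar>u x\<bar>"
    unfolding c_def by (intro mult_right_mono) auto
  then have cA: "c \<le> norm (A x)" by (simp add: norm_A)
  have c0: "c \<ge> 0" by (simp add: c_def)
  have cp: "c powr (p - 1) = (h - \<kappa>) * \<bar>u x\<bar> powr (p - 1)"
    using \<kappa> p_gt_1 by (simp add: c_def h_def powr_mult powr_powr)
  have "\<bar>s\<bar> \<le> 1 * (norm x * norm (G x))"
    unfolding s_def abs_mult by (intro mult_mono Cauchy_Schwarz_ineq2) (auto simp: sgn_if)
  then have s: "s \<le> norm x * norm (G x)" by simp
  have "c powr (p - 1) * s \<le> c powr (p - 1) * (norm x * norm (G x))"
    using s by (intro mult_left_mono) auto
  then have "p * (c powr (p - 1) * s) \<le> p * (c powr (p - 1) * (norm x * norm (G x)))"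
    by (rule mult_left_mono) (use p_gt_1 in simp)
  also have "\<dots> = norm x * (p * (norm (G x) * c powr (p - 1)))" by simp
  also have "\<dots> \<le> norm x * (norm (G x) powr p + (p - 1) * c powr p)"
    using p_gt_1 c0 by (intro mult_left_mono Young_tangent) auto
  also have "\<dots> \<le> norm x * (norm (G x) powr p + (p - 1) * norm (A x) powr p)"
    using p_gt_1 c0 cA by (intro mult_left_mono add_left_mono powr_mono2) auto
  finally have 1: "p * ((h - \<kappa>) * \<bar>u x\<bar> powr (p - 1) * s)
      \<le> norm x * (norm (G x) powr p + (p - 1) * norm (A x) powr p)" unfolding cp .
  have "norm x * (\<alpha> powr (p - 1) / norm x powr p) = h"
    using N by (simp add: h_def powr_divide powr_diff mult.commute)
  \<comment> \<open>The mixed term of D carries the full potential h, while the bound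
    \<open>1\<close> carries h - \<kappa>; their difference is the term with \<kappa>.\<close>
  then have "norm x * (p * (norm (A x) powr (p - 2) * (A x \<bullet> G x))) = p * (h * \<bar>u x\<bar> powr (p - 1) * s)"
    unfolding sgn_powr_A[OF x] s_def by (auto simp: field_simps)
  then have "norm x * D x = norm x * (norm (G x) powr p + (p - 1) * norm (A x) powr p)
      - p * (h * \<bar>u x\<bar> powr (p - 1) * s)"
    unfolding D_def bregman_def by (simp only: right_diff_distrib distrib_left)
  also have "\<dots> \<ge> - (p * (\<kappa> * \<bar>u x\<bar> powr (p - 1) * s))"
    using 1 by (simp add: algebra_simps)
  finally show ?thesis by (simp add: s_def inner_commute algebra_simps)
qed

text \<open>The constant and the power of L together are \<kappa>^(-1/p) with \<kappa> = (\<alpha> /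
  (2 L))^(p-1).\<close>

lemma abs_u_le_of_dim_1:
  assumes dim: "DIM('a) = 1" and \<Omega>: "open \<Omega>" "connected \<Omega>" "0 \<in> \<Omega>"
    and out: "\<And>y. y \<notin> \<Omega> \<Longrightarrow> u y = 0"
    and L: "emeasure lborel \<Omega> = ennreal L" "L > 0"
  shows "\<bar>u x\<bar> \<le> (2 / \<alpha>) powr ((p - 1) / p) * L powr (1 - 1 / p) * (\<integral>x. D x \<partial>lborel) powr (1 / p)"
proof (cases "u x = 0")
  case False
  have [measurable]: "\<Omega> \<in> sets borel" using \<Omega> by auto
  have [measurable]: "D \<in> borel_measurable borel" by (rule borel_measurable_continuous_onI[OF contD])
  define I where "I = (\<integral>x. D x \<partial>lborel)"
  have I: "I \<ge> 0" unfolding I_def by (rule integral_D_nonneg)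
  have x: "x \<noteq> 0" using False near[of 0] r by auto
  have "convex \<Omega>" using \<Omega> dim connected_convex_1_gen by blast
  \<comment> \<open>The segment from 0 to z lies in the convex set \<open>\<Omega>\<close>, so its
    length is at most the measure L of \<open>\<Omega>\<close>.\<close>
  have bounded: "norm z \<le> L" if "z \<in> \<Omega>" for z
  proof -
    have "t *\<^sub>R z \<in> \<Omega>" if "t \<in> {0..1}" for t
      using \<open>convex \<Omega>\<close> \<open>0 \<in> \<Omega>\<close> \<open>z \<in> \<Omega>\<close> that convexD_alt[of \<Omega> 0 z t] by auto
    then have "(\<integral>\<^sup>+t. indicator \<Omega> (0 + t *\<^sub>R z) * indicator {0..1} t \<partial>lborel)
        = (\<integral>\<^sup>+t. indicator {0..1} (t::real) \<partial>lborel)"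
      by (intro nn_integral_cong) (auto split: split_indicator)
    then have "ennreal (norm z) \<le> ennreal L"
      using nn_integral_segment_le_dim_1[OF dim, of "indicator \<Omega>" z 0] L by simp
    then show ?thesis using L by simp
  qed
  \<comment> \<open>The point at distance 2 L from the origin on the ray through x. By
    \<open>bounded\<close> it lies outside \<open>\<Omega>\<close>, and it lies beyond x because |x|
    \<le> L.\<close>
  define y where "y = (2 * L / norm x) *\<^sub>R x"
  have ny: "norm y = 2 * L" using x L by (simp add: y_def)
  then have uy: "u y = 0" using bounded[of y] L out[of y] by auto
  have nx: "norm x \<le> L" using bounded[of x] out False by auto
  define \<beta> where "\<beta> = 2 * L / norm x - 1"
  have \<beta>: "\<beta> \<ge> 0" using nx x L by (simp add: \<beta>_def field_simps)
  have w: "y - x = \<beta> *\<^sub>R x" by (simp add: y_def \<beta>_def algebra_simps)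
  \<comment> \<open>The value of the potential (\<alpha> / |z|)^(p-1) at |z| = 2 L, its minimum on
    the segment; hence \<open>D_ge_derivative\<close> applies at every point of it.\<close>
  define \<kappa> where "\<kappa> = (\<alpha> / (2 * L)) powr (p - 1)"
  have \<kappa>: "\<kappa> > 0" using \<alpha>_pos L by (simp add: \<kappa>_def)
  define z where "z t = x + t *\<^sub>R (y - x)" for t
  have zx: "z t = (1 + t * \<beta>) *\<^sub>R x" for t by (simp add: z_def w algebra_simps)
  have "ennreal (\<kappa> * \<bar>u (z 0)\<bar> powr p) \<le> (\<integral>\<^sup>+t. ennreal (norm (y - x) * D (z t)) * indicator {0..1} t \<partial>lborel)"
  proof (rule nn_integral_ge_of_derivative_bound)
    fix t :: real assume t: "t \<in> {0..1}"
    have pos: "1 + t * \<beta> > 0" using t \<beta> by (simp add: add_pos_nonneg)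
    then have zt: "z t \<noteq> 0" using x by (simp add: zx)
    have "norm (z t) = (1 + t * \<beta>) * norm x" using pos by (simp add: zx)
    also have "\<dots> \<le> (1 + 1 * \<beta>) * norm x"
      using t \<beta> by (intro mult_right_mono add_left_mono) auto
    also have "\<dots> = 2 * L" using x by (simp add: \<beta>_def)
    finally have "\<alpha> / (2 * L) \<le> \<alpha> / norm (z t)"
      using zt \<alpha>_pos L by (intro divide_left_mono) auto
    then have \<kappa>z: "\<kappa> \<le> (\<alpha> / norm (z t)) powr (p - 1)"
      unfolding \<kappa>_def using \<alpha>_pos L p_gt_1 by (intro powr_mono2) auto
    have "(z has_derivative (\<lambda>h. h *\<^sub>R (y - x))) (at t)"
      unfolding z_def by (auto intro!: derivative_eq_intros)
    from has_derivative_compose[OF this has_derivative_abs_powr_u]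
    have "((\<lambda>t. \<bar>u (z t)\<bar> powr p) has_real_derivative
        p * (sgn (u (z t)) * \<bar>u (z t)\<bar> powr (p - 1)) * (G (z t) \<bullet> (y - x))) (at t)"
      by (rule has_derivative_imp_has_field_derivative) simp
    then show "((\<lambda>t. \<kappa> * \<bar>u (z t)\<bar> powr p) has_real_derivative
        \<kappa> * (p * (sgn (u (z t)) * \<bar>u (z t)\<bar> powr (p - 1)) * (G (z t) \<bullet> (y - x)))) (at t)"
      by (rule DERIV_cmult)
    \<comment> \<open>\<open>D_ge_derivative\<close> concerns the direction z t; the segment
      direction y - x is a nonnegative multiple of it.\<close>
    define \<gamma> where "\<gamma> = \<beta> / (1 + t * \<beta>)"
    have \<gamma>: "\<gamma> \<ge> 0" "y - x = \<gamma> *\<^sub>R z t"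
      using pos \<beta> by (auto simp: \<gamma>_def w zx)
    have "\<gamma> * - (\<kappa> * (p * (sgn (u (z t)) * \<bar>u (z t)\<bar> powr (p - 1)) * (G (z t) \<bullet> z t)))
        \<le> \<gamma> * (norm (z t) * D (z t))"
      using zt \<kappa> \<kappa>z \<gamma> by (intro mult_left_mono D_ge_derivative) auto
    then show "- (\<kappa> * (p * (sgn (u (z t)) * \<bar>u (z t)\<bar> powr (p - 1)) * (G (z t) \<bullet> (y - x))))
        \<le> norm (y - x) * D (z t)"
      using \<gamma>(1) unfolding \<gamma>(2) by (simp add: algebra_simps)
  next
    show "continuous_on {0..1} (\<lambda>t. norm (y - x) * D (z t))"
      unfolding z_def by (intro continuous_intros continuous_on_compose2[OF contD]) auto
  qed (use uy D_nonneg p_gt_1 in \<open>auto simp: z_def\<close>)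
  also have "\<dots> = ennreal (norm (y - x)) * (\<integral>\<^sup>+t. ennreal (D (x + t *\<^sub>R (y - x))) * indicator {0..1} t \<partial>lborel)"
    by (simp add: z_def ennreal_mult D_nonneg mult.assoc nn_integral_cmult)
  also have "\<dots> \<le> (\<integral>\<^sup>+x. ennreal (D x) \<partial>lborel)"
    by (rule nn_integral_segment_le_dim_1[OF dim]) measurable
  also have "\<dots> = ennreal I" by (simp add: nn_integral_D I_def)
  finally have "\<kappa> * \<bar>u x\<bar> powr p \<le> I" using I by (simp add: z_def)
  then have "\<bar>u x\<bar> powr p \<le> I / \<kappa>" using \<kappa> by (simp add: field_simps)
  then have "(\<bar>u x\<bar> powr p) powr (1 / p) \<le> (I / \<kappa>) powr (1 / p)"
    using p_gt_1 by (intro powr_mono2) auto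
  then have "\<bar>u x\<bar> \<le> (I / \<kappa>) powr (1 / p)" using p_gt_1 by (simp add: powr_powr)
  also have "\<dots> = I powr (1 / p) / \<kappa> powr (1 / p)"
    by (rule powr_divide)
  also have "\<kappa> powr (1 / p) = (\<alpha> / (2 * L)) powr ((p - 1) / p)"
    by (simp add: \<kappa>_def powr_powr)
  also have "I powr (1 / p) / \<dots> = (2 / \<alpha>) powr ((p - 1) / p) * L powr ((p - 1) / p) * I powr (1 / p)"
    using \<alpha>_pos L by (simp add: powr_divide powr_mult)
  finally have "\<bar>u x\<bar> \<le> (2 / \<alpha>) powr ((p - 1) / p) * L powr ((p - 1) / p) * I powr (1 / p)" .
  moreover have "(p - 1) / p = 1 - 1 / p" using p_gt_1 by (simp add: field_simps)
  ultimately show ?thesis by (simp only: I_def)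
qed simp

end

section \<open>Test functions\<close>

lemma has_derivative_gradient:
  fixes f :: "real ^ 'n::finite \<Rightarrow> real"
  assumes "f differentiable (at x)"
  shows "(f has_derivative (\<lambda>h. gradient f x \<bullet> h)) (at x)"
proof -
  define f' where "f' = frechet_derivative f (at x)"
  have f': "(f has_derivative f') (at x)"
    using assms frechet_derivative_works f'_def by blast
  then interpret linear f' by (rule has_derivative_linear)
  have "f' h = gradient f x \<bullet> h" for h
  proof -
    have "f' h = f' (\<Sum>i\<in>UNIV. h $ i *\<^sub>R axis i 1)"
      using basis_expansion[of h] by (simp add: scalar_mult_eq_scaleR)
    also have "\<dots> = (\<Sum>i\<in>UNIV. h $ i * f' (axis i 1))"
      by (simp add: sum scaleR)
    also have "\<dots> = gradient f x \<bullet> h"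
      by (simp add: inner_vec_def gradient_def partial_deriv_def f'_def mult.commute)
    finally show ?thesis .
  qed
  then have "f' = (\<lambda>h. gradient f x \<bullet> h)" by auto
  then show ?thesis using f' by simp
qed

text \<open>The open sets S and T, the complement of the support, cover the space. On S smoothness
  applies, and on T the function is zero.\<close>

lemma
  fixes u :: "real ^ 'n::finite \<Rightarrow> real"
  assumes u: "u \<in> Cc_infinity S" and "open S"
  shows Cc_infinity_has_derivative: "(u has_derivative (\<lambda>h. gradient u x \<bullet> h)) (at x)"
    and Cc_infinity_continuous_gradient: "continuous_on UNIV (gradient u)"
    and Cc_infinity_gradient_eq_0: "x \<notin> S \<Longrightarrow> gradient u x = 0"
proof -
  define T where "T = - closure {x. u x \<noteq> 0}"
  have T: "open T" and T0: "\<And>y. y \<in> T \<Longrightarrow> u y = 0"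
    using closure_subset[of "{x. u x \<noteq> 0}"] by (auto simp: T_def)
  have cover: "S \<union> T = UNIV" using u by (auto simp: T_def Cc_infinity_def)
  have C1: "Ck_on (Suc 0) S u" using u by (auto simp: Cc_infinity_def smooth_on_def)
  have diff: "u differentiable (at y)" for y
  proof (cases "y \<in> T")
    case True
    then have "(u has_derivative (\<lambda>_. 0)) (at y)"
      by (intro has_derivative_transform_within_open[OF has_derivative_const T]) (auto simp: T0)
    then show ?thesis by (rule differentiableI)
  next
    case False
    then show ?thesis using cover C1 by auto
  qed
  then show der: "(u has_derivative (\<lambda>h. gradient u y \<bullet> h)) (at y)" for y
    by (rule has_derivative_gradient)
  have G0: "gradient u y = 0" if "y \<in> T" for y
    by (rule gradient_eq_0_on_open[where G="gradient u", OF der T that]) (rule T0)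
  then show "x \<notin> S \<Longrightarrow> gradient u x = 0" using cover by auto
  have "continuous_on S (gradient u)"
    unfolding gradient_def using C1 by (intro continuous_on_vec_lambda) auto
  moreover have "continuous_on T (gradient u)"
    using G0 by (subst continuous_on_cong[OF refl, of _ _ "\<lambda>_. 0"]) auto
  ultimately show "continuous_on UNIV (gradient u)"
    using continuous_on_open_Un[OF \<open>open S\<close> T] cover by simp
qed

lemma set_integral_lebesgue_eq_lborel:
  fixes f :: "'a::euclidean_space \<Rightarrow> real"
  assumes "continuous_on UNIV f" "\<And>x. x \<notin> \<Omega> \<Longrightarrow> f x = 0"
  shows "(LINT x:\<Omega>|lebesgue. f x) = (\<integral>x. f x \<partial>lborel)"
proof -
  have eq: "(\<lambda>x. indicator \<Omega> x *\<^sub>R f x) = f"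
    using assms(2) by (auto simp: indicator_def fun_eq_iff)
  show ?thesis
    unfolding set_lebesgue_integral_def eq
    using borel_measurable_continuous_onI[OF assms(1)] by (intro integral_completion) simp
qed

text \<open>The support is compact and misses the origin, which supplies the inner radius r and the
  outer radius M; set integrals over \<open>\<Omega>\<close> become integrals over the space because
  the integrands vanish outside.\<close>

lemma hardy_Morrey_data:
  fixes u :: "real ^ 'n::finite \<Rightarrow> real"
  assumes p: "p > real CARD('n)" and "open \<Omega>" and u: "u \<in> Cc_infinity (\<Omega> - {0})"
  obtains r M where "punctured_test_function u (gradient u) r M p"
    and "hardy_difference p \<Omega> u = (\<integral>x. punctured_test_function.D u (gradient u) p x \<partial>lborel)"
    and "\<And>y. y \<notin> \<Omega> \<Longrightarrow> u y = 0"
proof -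
  define F where "F = closure {x. u x \<noteq> 0}"
  have F: "compact F" "F \<subseteq> \<Omega> - {0}" and F0: "\<And>y. y \<notin> F \<Longrightarrow> u y = 0"
    using u closure_subset[of "{x. u x \<noteq> 0}"] by (auto simp: F_def Cc_infinity_def)
  obtain M where M: "\<And>y. y \<in> F \<Longrightarrow> norm y \<le> M"
    using compact_imp_bounded[OF F(1)] bounded_iff by blast
  obtain r where r: "r > 0" "ball 0 r \<subseteq> - F"
    using F compact_imp_closed[OF F(1)] open_contains_ball[of "- F"] by (metis ComplI Diff_iff open_Compl singletonI subsetD)
  have S: "open (\<Omega> - {0})" using \<open>open \<Omega>\<close> by auto
  interpret punctured_test_function u "gradient u" r M p
  proof
    show "u x = 0" if "norm x < r" for x using that r F0 by (auto simp: subset_iff)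
    show "u x = 0" if "norm x > M" for x using that M F0 by force
  qed (use Cc_infinity_has_derivative[OF u S] Cc_infinity_continuous_gradient[OF u S] r p in auto)
  have out: "u y = 0" if "y \<notin> \<Omega>" for y using that F F0 by blast
  have "hardy_difference p \<Omega> u = (\<integral>x. D x \<partial>lborel)"
    unfolding hardy_difference_def integral_D \<alpha>_def
    using out Cc_infinity_gradient_eq_0[OF u S]
    by (simp add: set_integral_lebesgue_eq_lborel[OF cont_gradient_powr]
        set_integral_lebesgue_eq_lborel[OF cont_hardy_potential])
  then show ?thesis
    using that out punctured_test_function_axioms by blast
qed

text \<open>Nonnegativity of the Hardy difference is part of the conclusion, so that its power 1 / p
  is a genuine root.\<close>

theorem theoremV:
  fixes p :: real
  assumes "p > real CARD('n::finite)"
  shows "\<exists>C>0. \<forall>\<Omega> :: (real ^ 'n) set. \<forall>u.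
           open \<Omega> \<and> connected \<Omega> \<and> 0 \<in> \<Omega> \<and> emeasure lebesgue \<Omega> < \<infinity> \<and>
           u \<in> Cc_infinity (\<Omega> - {0}) \<longrightarrow>
             0 \<le> hardy_difference p \<Omega> u \<and>
             (SUP x\<in>\<Omega>. \<bar>u x\<bar>)
               \<le> C * measure lebesgue \<Omega> powr (1 / real CARD('n) - 1 / p)
                   * hardy_difference p \<Omega> u powr (1 / p)"
proof -
  define n where "n = real CARD('n)"
  define \<alpha> where "\<alpha> = (p - n) / p"
  \<comment> \<open>Dimension one is separated because only there can p < 2 occur.\<close>
  define C where "C = (if CARD('n) = 1 then (2 / \<alpha>) powr ((p - 1) / p)
    else n * 2 powr (1 / n) * 2 powr ((p - 1) / p) / \<alpha>)"
  have n: "n > 0" by (simp add: n_def)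
  have \<alpha>: "\<alpha> > 0" using assms n by (simp add: \<alpha>_def n_def)
  have C: "C > 0" using \<alpha> n by (simp add: C_def)
  have main: "0 \<le> hardy_difference p \<Omega> u \<and> (SUP x\<in>\<Omega>. \<bar>u x\<bar>)
      \<le> C * measure lebesgue \<Omega> powr (1 / n - 1 / p) * hardy_difference p \<Omega> u powr (1 / p)"
    if \<Omega>: "open \<Omega>" "connected \<Omega>" "0 \<in> \<Omega>" "emeasure lebesgue \<Omega> < \<infinity>" and u: "u \<in> Cc_infinity (\<Omega> - {0})"
    for \<Omega> :: "(real ^ 'n) set" and u
  proof -
    obtain r M where ptf: "punctured_test_function u (gradient u) r M p"
      and hd: "hardy_difference p \<Omega> u = (\<integral>x. punctured_test_function.D u (gradient u) p x \<partial>lborel)"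
      and out: "\<And>y. y \<notin> \<Omega> \<Longrightarrow> u y = 0"
      using hardy_Morrey_data[OF assms \<Omega>(1) u] by blast
    interpret P: punctured_test_function u "gradient u" r M p by (rule ptf)
    define L where "L = measure lebesgue \<Omega>"
    have "emeasure lborel \<Omega> = emeasure lebesgue \<Omega>"
      using \<Omega>(1) by (simp add: emeasure_completion)
    then have EL: "emeasure lborel \<Omega> = ennreal L"
      unfolding L_def using \<Omega>(4) by (simp add: emeasure_eq_ennreal_measure)
    have "\<not> negligible \<Omega>"
      using \<Omega> open_not_negligible by blast
    then have "emeasure lborel \<Omega> \<noteq> 0"
      using \<Omega>(1) by (auto simp: negligible_iff_null_sets null_sets_def emeasure_completion)
    then have Lpos: "L > 0"
      using EL by (cases "L > 0") (auto simp: ennreal_neg)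
    have "\<bar>u x\<bar> \<le> C * L powr (1 / n - 1 / p) * hardy_difference p \<Omega> u powr (1 / p)" for x
    proof (cases "CARD('n) = 1")
      case True
      then show ?thesis
        using P.abs_u_le_of_dim_1[OF _ \<Omega>(1-3) out EL Lpos, of x]
        by (simp add: C_def hd n_def P.\<alpha>_def \<alpha>_def)
    next
      case False
      then have "p \<ge> 2" using assms zero_less_card_finite[where 'a='n] by linarith
      then show ?thesis
        using P.abs_u_le_of_p_ge_2[OF _ \<Omega>(1) out EL Lpos, of x] False
        by (simp add: C_def hd n_def P.\<alpha>_def \<alpha>_def)
    qed
    \<comment> \<open>The origin makes the index set nonempty, and the uniform bound makes the
      values bounded, so \<open>SUP\<close> is a genuine supremum.\<close>
    then have "(SUP x\<in>\<Omega>. \<bar>u x\<bar>) \<le> C * L powr (1 / n - 1 / p) * hardy_difference p \<Omega> u powr (1 / p)"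
      using \<Omega>(3) by (intro cSUP_least) auto
    then show ?thesis
      using P.integral_D_nonneg by (simp add: L_def hd)
  qed
  show ?thesis
    using C main unfolding n_def by blast
qed

end
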